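(* Let $n,m\in\mathbb{N}$, let $A\in\mathbb{R}^{n\times n}$ be Hurwitz, let $B\in\mathbb{R}^{n\times m}$ be such that $(A,B)$ is controllable, and let $C\in\mathbb{R}^{m\times n}$, $D\in\mathbb{R}^{m\times m}$ with $D+D^{\mathsf T}$ symmetric positive semi-definite. Let $M\in\mathbb{R}^{m\times m}$ be the square root of $D+D^{\mathsf T}$ (so $MM^{\mathsf T}=D+D^{\mathsf T}$). For $L\in\mathbb{R}^{n\times m}$ define $$\widehat{C}(L)=B^{\mathsf T}\mathcal{L}^{-1}\big(-LL^{\mathsf T}\big)+ML^{\mathsf T},\qquad \mathcal{L}(X)=A^{\mathsf T}X+XA,$$ $$G(s)=C(sI_n-A)^{-1}B+D,\qquad \widehat{G}(s;L)=\widehat{C}(L)(sI_n-A)^{-1}B+D,$$ $$\mathcal{J}(L)=\big\|G-\widehat{G}(\cdot;L)\big\|_{\mathcal{H}_2}^2 .$$ Then the minimization problem $$\min_{L\in\mathbb{R}^{n\times m}}\mathcal{J}(L)$$ is solvable (i.e. a global minimizer exists), and for any minimizers $L_1,L_2\in\mathbb{R}^{n\times m}$ we have $\widehat{C}(L_1)=\widehat{C}(L_2)$; that is, the minimizing passive system $\dot x=Ax+Bu$, $y=\widehat{C}(L)x+Du$ is unique.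
   Context: A real square matrix is Hurwitz if all its eigenvalues have negative real part. Since $A$ is Hurwitz, the Lyapunov operator $\mathcal{L}\colon\mathbb{R}^{n\times n}\to\mathbb{R}^{n\times n}$ is invertible. For a transfer function $H$ the $\mathcal{H}_2$-norm is given by $\|H\|_{\mathcal{H}_2}^2=\frac{1}{2\pi}\int_{-\infty}^{\infty}\|H(\mathrm{i}\omega)\|_{\mathrm F}^2\,\mathrm{d}\omega$, where $\|\cdot\|_{\mathrm F}$ is the Frobenius norm. A system $\dot x=Ax+Bu$, $y=\widehat{C}x+Du$ is called passive if there exists a function $\mathcal{H}\colon\mathbb{R}^n\to[0,\infty)$ such that $\mathcal{H}(x(t_2))\le\mathcal{H}(x(t_1))+\int_{t_1}^{t_2}u(t)^{\mathsf T}y(t)\,\mathrm{d}t$ for all solution trajectories $(u,x,y)$ and all $t_1\le t_2$. *)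

theory Defs
  imports "HOL-Analysis.Analysis"
begin

section \<open>Matrices\<close>

definition cmatrix :: "real^'n^'m \<Rightarrow> complex^'n^'m" where
  "cmatrix A = map_matrix complex_of_real A"

definition eigenvalue :: "complex^'n^'n \<Rightarrow> complex \<Rightarrow> bool" where
  "eigenvalue A z \<longleftrightarrow> (\<exists>v. v \<noteq> 0 \<and> A *v v = z *s v)"

definition hurwitz :: "real^'n^'n \<Rightarrow> bool" where
  "hurwitz A \<longleftrightarrow> (\<forall>z. eigenvalue (cmatrix A) z \<longrightarrow> Re z < 0)"

definition sym_psd :: "real^'n^'n \<Rightarrow> bool" where
  "sym_psd S \<longleftrightarrow> transpose S = S \<and> (\<forall>x. 0 \<le> x \<bullet> (S *v x))"

text \<open>The square root of a positive semi-definite matrix is the unique positive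
  semi-definite matrix with the given square.\<close>

definition psd_sqrt_of :: "real^'n^'n \<Rightarrow> real^'n^'n \<Rightarrow> bool" where
  "psd_sqrt_of M S \<longleftrightarrow> sym_psd M \<and> M ** M = S"

definition lyapunov :: "real^'n^'n \<Rightarrow> real^'n^'n \<Rightarrow> real^'n^'n" where
  "lyapunov A X = transpose A ** X + X ** A"

section \<open>Linear systems\<close>

text \<open>Inputs are the locally square-integrable functions, so that the supplied energy
  \<open>\<integral> u\<^sup>T y\<close> is finite on bounded intervals.\<close>

definition locally_L2 :: "(real \<Rightarrow> real^'m) \<Rightarrow> bool" where
  "locally_L2 u \<longleftrightarrow> u \<in> borel_measurable lebesgue \<and>
     (\<forall>a b. set_integrable lebesgue {a..b} (\<lambda>t. (norm (u t))\<^sup>2))"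

text \<open>Solutions of \<open>x' = A x + B u\<close> are understood in the sense of Caratheodory,
  that is, the differential equation holds in its integrated form.\<close>

definition state_trajectory ::
  "real^'n^'n \<Rightarrow> real^'m^'n \<Rightarrow> (real \<Rightarrow> real^'m) \<Rightarrow> (real \<Rightarrow> real^'n) \<Rightarrow> bool" where
  "state_trajectory A B u x \<longleftrightarrow> locally_L2 u \<and>
     (\<forall>a b. a \<le> b \<longrightarrow> ((\<lambda>t. A *v x t + B *v u t) has_integral (x b - x a)) {a..b})"

definition solution_trajectory ::
  "real^'n^'n \<Rightarrow> real^'m^'n \<Rightarrow> real^'n^'p \<Rightarrow> real^'m^'p
    \<Rightarrow> (real \<Rightarrow> real^'m) \<Rightarrow> (real \<Rightarrow> real^'n) \<Rightarrow> (real \<Rightarrow> real^'p) \<Rightarrow> bool" where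
  "solution_trajectory A B C D u x y \<longleftrightarrow>
     state_trajectory A B u x \<and> (\<forall>t. y t = C *v x t + D *v u t)"

definition controllable :: "real^'n^'n \<Rightarrow> real^'m^'n \<Rightarrow> bool" where
  "controllable A B \<longleftrightarrow>
     (\<forall>x0 x1. \<exists>T>0. \<exists>u x. state_trajectory A B u x \<and> x 0 = x0 \<and> x T = x1)"

definition passive_system ::
  "real^'n^'n \<Rightarrow> real^'m^'n \<Rightarrow> real^'n^'m \<Rightarrow> real^'m^'m \<Rightarrow> bool" where
  "passive_system A B C D \<longleftrightarrow>
     (\<exists>H :: real^'n \<Rightarrow> real. (\<forall>z. 0 \<le> H z) \<and>
       (\<forall>u x y t1 t2. solution_trajectory A B C D u x y \<and> t1 \<le> t2 \<longrightarrow>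
          H (x t2) \<le> H (x t1) + integral {t1..t2} (\<lambda>t. u t \<bullet> y t)))"

definition transfer_function ::
  "real^'n^'n \<Rightarrow> real^'m^'n \<Rightarrow> real^'n^'p \<Rightarrow> real^'m^'p \<Rightarrow> complex \<Rightarrow> complex^'m^'p" where
  "transfer_function A B C D s =
     cmatrix C ** matrix_inv (mat s - cmatrix A) ** cmatrix B + cmatrix D"

text \<open>The library's norm on \<open>complex^'m^'p\<close> (Euclidean norm of the Euclidean norms of the
  rows) is the Frobenius norm.\<close>

definition h2_norm :: "(complex \<Rightarrow> complex^'m^'p) \<Rightarrow> real" where
  "h2_norm H = sqrt (1 / (2 * pi) * (LINT \<omega>|lborel. (norm (H (\<i> * complex_of_real \<omega>)))\<^sup>2))"

section \<open>The passivation problem\<close>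

text \<open>\<open>inv (lyapunov A)\<close> is the inverse of the Lyapunov operator, which is bijective for
  Hurwitz \<open>A\<close>.\<close>

definition C_hat ::
  "real^'n^'n \<Rightarrow> real^'m^'n \<Rightarrow> real^'m^'m \<Rightarrow> real^'m^'n \<Rightarrow> real^'n^'m" where
  "C_hat A B M L =
     transpose B ** inv (lyapunov A) (- (L ** transpose L)) + M ** transpose L"

definition J_cost ::
  "real^'n^'n \<Rightarrow> real^'m^'n \<Rightarrow> real^'n^'m \<Rightarrow> real^'m^'m \<Rightarrow> real^'m^'m \<Rightarrow> real^'m^'n \<Rightarrow> real" where
  "J_cost A B C D M L =
     (h2_norm (\<lambda>s. transfer_function A B C D s
                  - transfer_function A B (C_hat A B M L) D s))\<^sup>2"

end

theory Submission
  imports Defs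
begin

text \<open>
  The cost is a quadratic form in the error \<open>E = C - C_hat L\<close>, positive definite by controllability. So
  uniqueness follows once the set of all \<open>C_hat L\<close> is convex. An output matrix \<open>C'\<close> lies in that set iff
  some symmetric \<open>Q\<close> satisfies \<open>2 (x \<bullet> Q (A x + B u)) \<le> 2 (u \<bullet> C' x) + |M u|\<^sup>2\<close> for all \<open>x\<close>, \<open>u\<close>, a condition
  that is convex in \<open>(Q, C')\<close> and also gives passivity with storage function \<open>x \<bullet> Q x / 2\<close>. The hard
  direction (from \<open>Q\<close> to \<open>L\<close>) is the positive real lemma: for invertible \<open>M\<close> Newton's method started
  at the gain \<open>0\<close> increases monotonically to a solution of the Riccati equation below \<open>Q\<close>, and general \<open>M\<close>
  is reached by a limit. Existence holds because \<open>C_hat\<close> is coercive in \<open>L\<close>: a degenerate limit would be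
  a Lyapunov solution \<open>Z\<close> with \<open>Z B = 0\<close>, which vanishes by controllability.
\<close>

section \<open>Lyapunov stability\<close>

text \<open>\<open>C_hat\<close> is quadratic in \<open>L\<close>, so the cost need not be convex in
  the variable over which it is minimised. Convexity appears only in the image, which is why
  uniqueness is claimed for \<open>C_hat L\<close> and not for \<open>L\<close>. Stability enters
  through a quadratic certificate instead of a decaying flow. From it follows a comparison
  principle: a symmetric \<open>X\<close> whose form does not increase along \<open>A\<close> is
  positive semidefinite. This orders the Newton iterates and keeps them below \<open>Q\<close>, and
  the certificate itself is carried from one closed loop to the next. Spectral information is needed
  only to produce the first certificate and to bound the resolvent on the imaginary axis. The start
  at gain \<open>0\<close> is available because its closed loop is \<open>A\<close> itself. In the
  limit towards a singular \<open>M\<close> the inverses blow up, so no bound can come from them. It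
  comes from the Riccati solutions \<open>X\<close>, which all lie between \<open>0\<close> and the
  same \<open>Q\<close> and so control \<open>L ** transpose L = - lyapunov A X\<close>
  uniformly.\<close>

lemma psd_form_zero:
  fixes r :: "'a::real_vector \<Rightarrow> 'a \<Rightarrow> real"
  assumes "bilinear r" and sym: "\<And>x y. r x y = r y x" and nonneg: "\<And>x. 0 \<le> r x x" and "r v v = 0"
  shows "r v y = 0"
proof (rule ccontr)
  assume neq: "r v y \<noteq> 0"
  \<comment> \<open>Minimiser over \<open>t\<close> of
    \<open>2 * t * r v y + t\<^sup>2 * (r y y + 1)\<close>. The added 1 keeps the denominator
    positive when \<open>r y y\<close> vanishes.\<close>
  define t where "t = - r v y / (r y y + 1)"
  have c: "r y y + 1 > 0" using nonneg[of y] by linarith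
  have "0 \<le> r (v + t *\<^sub>R y) (v + t *\<^sub>R y)" by (rule nonneg)
  also have "\<dots> = 2 * t * r v y + t\<^sup>2 * r y y"
    using \<open>r v v = 0\<close> sym[of y v] by (simp add: bilinear_ladd[OF assms(1)] bilinear_radd[OF assms(1)]
      bilinear_lmul[OF assms(1)] bilinear_rmul[OF assms(1)] power2_eq_square algebra_simps)
  also have "\<dots> = - (r v y)\<^sup>2 * (r y y + 2) / (r y y + 1)\<^sup>2"
    using c by (simp add: t_def power2_eq_square divide_simps) (simp add: algebra_simps)
  also have "\<dots> < 0"
    using neq c by (intro divide_neg_pos) (auto simp: mult_neg_pos intro!: mult_neg_pos)
  finally show False by simp
qed

lemma bilinear_continuous_on_diagonal:
  fixes r :: "'a::euclidean_space \<Rightarrow> 'a \<Rightarrow> real"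
  assumes "bilinear r"
  shows "continuous_on S (\<lambda>x. r x x)"
  using assms bilinear_conv_bounded_bilinear bounded_bilinear.continuous_on continuous_on_id by blast

text \<open>At a minimiser \<open>v\<close> of \<open>q/p\<close> with negative value \<open>c\<close>, the form \<open>q - c p\<close> is
  positive semidefinite and vanishes at \<open>v\<close>, hence \<open>q v (f v) = c * p v (f v) > 0\<close>.\<close>

lemma lyapunov_form_nonneg:
  fixes p q :: "'a::euclidean_space \<Rightarrow> 'a \<Rightarrow> real"
  assumes p: "bilinear p" "\<And>x y. p x y = p y x" "\<And>x. x \<noteq> 0 \<Longrightarrow> 0 < p x x"
      "\<And>x. x \<noteq> 0 \<Longrightarrow> p x (f x) < 0"
    and q: "bilinear q" "\<And>x y. q x y = q y x" "\<And>x. q x (f x) \<le> 0"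
  shows "0 \<le> q x x"
proof (rule ccontr)
  assume "\<not> 0 \<le> q x x"
  then have qx: "q x x < 0" by simp
  then have x0: "x \<noteq> 0" using bilinear_lzero[OF q(1)] by auto
  have hom: "q (c *\<^sub>R y) (c *\<^sub>R y) = c\<^sup>2 * q y y" "p (c *\<^sub>R y) (c *\<^sub>R y) = c\<^sup>2 * p y y" for c y
    by (simp_all add: bilinear_lmul[OF p(1)] bilinear_rmul[OF p(1)] bilinear_lmul[OF q(1)] bilinear_rmul[OF q(1)] power2_eq_square)
  have un: "(1 / norm y) *\<^sub>R y \<in> sphere 0 1" if "y \<noteq> 0" for y :: 'a using that by simp
  have "continuous_on (sphere 0 1) (\<lambda>v. q v v / p v v)"
    using p(3) by (intro continuous_on_divide bilinear_continuous_on_diagonal[OF p(1)] bilinear_continuous_on_diagonal[OF q(1)])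
      (metis dist_0_norm less_irrefl mem_sphere norm_zero p(3) zero_neq_one)
  moreover have "sphere (0::'a) 1 \<noteq> {}" using un[OF x0] by blast
  ultimately obtain v where v: "v \<in> sphere 0 1" "\<And>w. w \<in> sphere 0 1 \<Longrightarrow> q v v / p v v \<le> q w w / p w w"
    using continuous_attains_inf[OF compact_sphere, of 0 1 "\<lambda>v. q v v / p v v"] by blast
  define c where "c = q v v / p v v"
  have v0: "v \<noteq> 0" using v(1) by auto
  have le: "c * p y y \<le> q y y" for y
  proof (cases "y = 0")
    case False
    have "c \<le> q y y / p y y" using v(2)[OF un[OF False]] False unfolding hom c_def by simp
    then show ?thesis using p(3)[OF False] by (simp add: field_simps)
  qed (simp add: bilinear_lzero[OF p(1)] bilinear_lzero[OF q(1)])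
  have "c < 0" using le[of x] qx p(3)[OF x0]
    by (smt (verit) mult_nonneg_nonneg)
  define r where "r = (\<lambda>x y. q x y - c * p x y)"
  have "bilinear r"
    using p(1) q(1) unfolding r_def bilinear_def linear_iff by (simp add: algebra_simps)
  moreover have "r v v = 0" using p(3)[OF v0] by (simp add: r_def c_def)
  moreover have "r x y = r y x" "0 \<le> r x x" for x y
    using p(2)[of x y] q(2)[of x y] le[of x] by (simp_all add: r_def)
  ultimately have "r v (f v) = 0"
    using psd_form_zero[of r v] by blast
  moreover have "c * p v (f v) > 0" using \<open>c < 0\<close> p(4)[OF v0] by (simp add: mult_neg_neg)
  ultimately show False using q(3)[of v] by (simp add: r_def)
qed

section \<open>Symmetric matrices and the Lyapunov operator\<close>

lemma sym_matrix_dot: "transpose X = X \<Longrightarrow> (X *v x) \<bullet> y = x \<bullet> (X *v y)" for X :: "real^'n^'n"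
  by (metis dot_lmul_matrix transpose_matrix_vector)

lemma bilinear_matrix: "bilinear (\<lambda>x y. (X *v x) \<bullet> y)" for X :: "real^'n^'m"
  by (simp add: bilinear_def linear_iff algebra_simps inner_simps)

lemma lyapunov_dot:
  fixes X :: "real^'n^'n"
  shows "x \<bullet> (lyapunov A X *v y) = (A *v x) \<bullet> (X *v y) + x \<bullet> (X *v (A *v y))"
  by (simp add: lyapunov_def algebra_simps inner_simps matrix_vector_mul_assoc[symmetric])
     (metis dot_lmul_matrix inner_commute)

lemma matrix_eq_dot: "X = Y \<longleftrightarrow> (\<forall>x y. x \<bullet> (X *v y) = x \<bullet> (Y *v y))" for X Y :: "real^'n^'m"
  by (metis matrix_eq vector_eq_rdot inner_commute)

lemma sym_matrix_eq_dot:
  fixes X Y :: "real^'n^'n"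
  assumes "transpose X = X" "transpose Y = Y" and eq: "\<And>x. x \<bullet> (X *v x) = x \<bullet> (Y *v x)"
  shows "X = Y"
proof -
  have "x \<bullet> (X *v y) = x \<bullet> (Y *v y)" for x y
    using eq[of "x + y"] eq[of x] eq[of y] sym_matrix_dot[OF assms(1), of x y] sym_matrix_dot[OF assms(2), of x y]
    by (simp add: algebra_simps inner_simps inner_commute)
  then show ?thesis by (simp add: matrix_eq_dot)
qed

lemma transpose_add: "transpose (A + B) = transpose A + transpose B" 
  and transpose_diff: "transpose (A - B) = transpose A - transpose (B :: real^'n^'m)" 
  and transpose_uminus: "transpose (- B) = - transpose B"
  for A B :: "real^'n^'m"
  by (simp_all add: transpose_def vec_eq_iff)

lemma transpose_lyapunov: "transpose (lyapunov A X) = lyapunov A (transpose X)"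
  by (simp add: lyapunov_def transpose_add matrix_transpose_mul add.commute)

text \<open>Lyapunov's criterion, taken as the working notion of stability: Newton's method delivers
  inequalities between quadratic forms for its closed loops, and these yield a new \<open>P\<close>
  directly, with no reference to eigenvalues.\<close>

definition lyapunov_stable :: "real^'n^'n \<Rightarrow> bool" where
  "lyapunov_stable A \<longleftrightarrow> (\<exists>P. transpose P = P \<and> (\<forall>x. x \<noteq> 0 \<longrightarrow> 0 < x \<bullet> (P *v x))
      \<and> (\<forall>x. x \<noteq> 0 \<longrightarrow> x \<bullet> (P *v (A *v x)) < 0))"

text \<open>The comparison principle. Heuristically, \<open>x \<bullet> X x\<close> does not
  increase along the flow of \<open>A\<close> and tends to 0, so it was nonnegative at the start.
  The extremal argument for forms replaces the flow.\<close>

lemma lyapunov_stable_nonneg: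
  assumes "lyapunov_stable A" "transpose X = X" "\<And>x. x \<bullet> (X *v (A *v x)) \<le> 0"
  shows "0 \<le> x \<bullet> (X *v x)"
proof -
  obtain P where P: "transpose P = P" "\<And>x. x \<noteq> 0 \<Longrightarrow> 0 < x \<bullet> (P *v x)" "\<And>x. x \<noteq> 0 \<Longrightarrow> x \<bullet> (P *v (A *v x)) < 0"
    using assms(1) unfolding lyapunov_stable_def by blast
  have "0 \<le> (X *v x) \<bullet> x"
  proof (rule lyapunov_form_nonneg[where p="\<lambda>x y. (P *v x) \<bullet> y" and f="\<lambda>x. A *v x" and q="\<lambda>x y. (X *v x) \<bullet> y"])
    show "(P *v x) \<bullet> y = (P *v y) \<bullet> x" "(X *v x) \<bullet> y = (X *v y) \<bullet> x" for x y
      using sym_matrix_dot[OF P(1), of x y] sym_matrix_dot[OF assms(2), of x y] by (simp_all only: inner_commute[of x])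
    show "0 < (P *v x) \<bullet> x" "(P *v x) \<bullet> (A *v x) < 0" if "x \<noteq> 0" for x
      using P(2,3)[OF that] by (simp_all only: sym_matrix_dot[OF P(1)])
    show "(X *v x) \<bullet> (A *v x) \<le> 0" for x
      using assms(3) by (simp only: sym_matrix_dot[OF assms(2)])
  qed (rule bilinear_matrix)+
  then show ?thesis by (simp add: inner_commute)
qed

lemma linear_lyapunov: "linear (lyapunov A)"
proof (rule linearI)
  show "lyapunov A (X + Y) = lyapunov A X + lyapunov A Y" for X Y
    by (simp add: lyapunov_def vec_eq_iff matrix_matrix_mult_def sum.distrib distrib_left distrib_right)
  show "lyapunov A (c *\<^sub>R X) = c *\<^sub>R lyapunov A X" for c X
    unfolding lyapunov_def by (vector matrix_matrix_mult_def sum_distrib_left distrib_left mult_ac)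
qed

text \<open>The forms on pairs make \<open>X\<close> the off-diagonal block of a symmetric matrix, so \<open>X\<close> itself
  need not be symmetric.\<close>

lemma lyapunov_stable_inj:
  assumes "lyapunov_stable A" shows "inj (lyapunov A)"
proof -
  obtain P where P: "transpose P = P" "\<And>x. x \<noteq> 0 \<Longrightarrow> 0 < x \<bullet> (P *v x)" "\<And>x. x \<noteq> 0 \<Longrightarrow> x \<bullet> (P *v (A *v x)) < 0"
    using assms unfolding lyapunov_stable_def by blast
  have P0: "0 \<le> x \<bullet> (P *v x)" "x \<bullet> (P *v (A *v x)) \<le> 0" for x
    using P(2,3)[of x] by (cases "x = 0"; force)+
  have nonneg: "0 \<le> fst z \<bullet> (X *v snd z)" if X: "lyapunov A X = 0" for X z
  proof -
    define p where "p = (\<lambda>z w. (P *v fst z) \<bullet> fst w + (P *v snd z) \<bullet> snd w)"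
    define q where "q = (\<lambda>z w. fst z \<bullet> (X *v snd w) + fst w \<bullet> (X *v snd z))"
    have "0 \<le> q z z"
    proof (rule lyapunov_form_nonneg[where p=p and q=q and f="\<lambda>z. (A *v fst z, A *v snd z)"])
      show "bilinear p" "bilinear q"
        by (auto simp: p_def q_def bilinear_def linear_iff algebra_simps inner_simps)
      show "p x y = p y x" "q x y = q y x" for x y
        using sym_matrix_dot[OF P(1), of "fst x" "fst y"] sym_matrix_dot[OF P(1), of "snd x" "snd y"]
        by (simp_all add: p_def q_def inner_commute[of "fst x" "P *v fst y"] inner_commute[of "snd x" "P *v snd y"])
      show "0 < p x x" "p x (A *v fst x, A *v snd x) < 0" if "x \<noteq> 0" for x
      proof -
        have "fst x \<noteq> 0 \<or> snd x \<noteq> 0" using that by (simp add: prod_eq_iff)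
        then show "0 < p x x" "p x (A *v fst x, A *v snd x) < 0"
          using P(2)[of "fst x"] P0[of "fst x"] P(2)[of "snd x"] P0[of "snd x"] P(3)[of "fst x"] P(3)[of "snd x"]
          unfolding p_def sym_matrix_dot[OF P(1)] by auto
      qed
      show "q x (A *v fst x, A *v snd x) \<le> 0" for x
        using lyapunov_dot[of "fst x" A X "snd x"] by (simp add: q_def X)
    qed
    then show ?thesis by (simp add: q_def)
  qed
  have "X = 0" if "lyapunov A X = 0" for X
  proof -
    \<comment> \<open>Flipping the sign of the first component reverses the inequality, so the mixed
      form vanishes.\<close>
    have "x \<bullet> (X *v y) = 0" for x y using nonneg[OF that, of "(x, y)"] nonneg[OF that, of "(- x, y)"] by simp
    then show ?thesis by (simp add: matrix_eq_dot)
  qed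
  then show ?thesis by (simp add: linear_injective_0[OF linear_lyapunov])
qed

lemma inv_lyapunov:
  assumes "lyapunov_stable A"
  shows "lyapunov A (inv (lyapunov A) W) = W" "inv (lyapunov A) (lyapunov A X) = X"
proof -
  note inj = lyapunov_stable_inj[OF assms]
  have "surj (lyapunov A)" using linear_inj_imp_surj[OF linear_lyapunov inj] .
  then show "lyapunov A (inv (lyapunov A) W) = W" by (rule surj_f_inv_f)
  show "inv (lyapunov A) (lyapunov A X) = X" using inj by (rule inv_f_f)
qed

lemma transpose_inv_lyapunov:
  assumes "lyapunov_stable A" "transpose W = W"
  shows "transpose (inv (lyapunov A) W) = inv (lyapunov A) W"
proof -
  have "lyapunov A (transpose (inv (lyapunov A) W)) = lyapunov A (inv (lyapunov A) W)"
    using transpose_lyapunov[of A "inv (lyapunov A) W"] inv_lyapunov(1)[OF assms(1), of W] assms(2) by simp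
  then show ?thesis by (rule injD[OF lyapunov_stable_inj[OF assms(1)]])
qed

lemma lyapunov_diag:
  assumes "transpose X = X"
  shows "x \<bullet> (lyapunov A X *v x) = 2 * (x \<bullet> (X *v (A *v x)))"
  unfolding lyapunov_dot inner_commute[of "A *v x" "X *v x"] sym_matrix_dot[OF assms] by linarith

lemma bounded_bilinear_matrix_vector_mult:
  "bounded_bilinear (\<lambda>(M :: real^'n^'m) x. M *v x)"
  unfolding bilinear_conv_bounded_bilinear[symmetric]
  by (auto simp: bilinear_def linear_iff algebra_simps scaleR_matrix_vector_assoc)

lemmas tendsto_matrix_vector_mult = bounded_bilinear.tendsto[OF bounded_bilinear_matrix_vector_mult]

lemma scaleR_mat_mult [simp]: "(c *\<^sub>R mat 1) *v x = c *\<^sub>R x" for x :: "real^'n"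
  by (simp add: scaleR_matrix_vector_assoc[symmetric])

lemma uminus_matrix_vector_mult: "(- A) *v x = - (A *v x)" for A :: "real^'n^'m"
  using matrix_vector_mult_diff_rdistrib[of 0 A x] by simp

lemma quadratic_form_upper_bound:
  fixes W :: "real^'n^'n"
  assumes "\<And>x. x \<noteq> 0 \<Longrightarrow> x \<bullet> (W *v x) < 0"
  obtains \<delta> where "\<delta> > 0" "\<And>x. x \<bullet> (W *v x) \<le> - \<delta> * (x \<bullet> x)"
proof -
  have "axis undefined 1 \<in> sphere (0 :: real^'n) 1" by simp
  then have "sphere (0 :: real^'n) 1 \<noteq> {}" by blast
  moreover have "continuous_on (sphere 0 1) (\<lambda>x. x \<bullet> (W *v x))"
    by (intro continuous_intros linear_continuous_on matrix_vector_mul_bounded_linear)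
  ultimately obtain v where v: "v \<in> sphere 0 1" "\<And>x. x \<in> sphere 0 1 \<Longrightarrow> x \<bullet> (W *v x) \<le> v \<bullet> (W *v v)"
    using continuous_attains_sup[OF compact_sphere, of 0 1 "\<lambda>x. x \<bullet> (W *v x)"] by blast
  show ?thesis
  proof
    show "- (v \<bullet> (W *v v)) > 0" using v(1) assms[of v] by fastforce
    show "x \<bullet> (W *v x) \<le> - (- (v \<bullet> (W *v v))) * (x \<bullet> x)" for x
    proof (cases "x = 0")
      case False
      let ?y = "(1 / norm x) *\<^sub>R x"
      have "?y \<bullet> (W *v ?y) \<le> v \<bullet> (W *v v)" using False by (intro v(2)) simp
      then have "x \<bullet> (W *v x) / (norm x)\<^sup>2 \<le> v \<bullet> (W *v v)"
        by (simp add: matrix_vector_mult_scaleR power2_eq_square)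
      then show ?thesis using False by (simp add: divide_simps power2_norm_eq_inner)
    qed simp
  qed
qed

section \<open>Eigenvalues on the imaginary axis\<close>

lemma mat_mult_vector: "mat z *v v = z *s v" for v :: "'a::semiring_1^'n"
  by (simp add: matrix_vector_mult_def mat_def vec_eq_iff if_distrib[of "\<lambda>x. x * _"] cong: if_cong)

lemma eigenvalue_iff_det: "eigenvalue M z \<longleftrightarrow> det (M - mat z) = 0"
proof -
  have "eigenvalue M z \<longleftrightarrow> (\<exists>v. v \<noteq> 0 \<and> (M - mat z) *v v = 0)"
    by (simp add: eigenvalue_def matrix_vector_mult_diff_rdistrib mat_mult_vector)
  also have "\<dots> \<longleftrightarrow> det (M - mat z) = 0"
    using matrix_left_invertible_ker[of "M - mat z"] invertible_left_inverse[of "M - mat z"] invertible_det_nz[of "M - mat z"]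
    by blast
  finally show ?thesis .
qed

lemma eigenvalue_transpose: "eigenvalue (transpose M) z \<longleftrightarrow> eigenvalue M z"
proof -
  have "transpose M - mat z = transpose (M - mat z)"
    by (simp add: transpose_def mat_def vec_eq_iff)
  then show ?thesis by (simp add: eigenvalue_iff_det det_transpose)
qed

lemma eigenvalue_diff_mat: "eigenvalue (M - mat c) z \<longleftrightarrow> eigenvalue M (z + c)"
proof -
  have "M - mat c - mat z = M - mat (z + c)" by (simp add: mat_def vec_eq_iff)
  then show ?thesis unfolding eigenvalue_iff_det by (simp only:)
qed

definition cvector :: "real^'n \<Rightarrow> complex^'n" where
  "cvector x = (\<chi> i. complex_of_real (x $ i))"

lemma cmatrix_mult_cvector: "cmatrix A *v cvector x = cvector (A *v x)"
  by (simp add: cmatrix_def cvector_def matrix_vector_mult_def vec_eq_iff)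

text \<open>Over the complex numbers \<open>A\<^sup>2 + k\<close> factors as
  \<open>(A - z) (A + z)\<close> with \<open>z = \<i> * sqrt k\<close>. Either \<open>A + z\<close>
  already kills \<open>w\<close>, so that \<open>- z\<close> is an eigenvalue, or
  \<open>(A + z) w\<close> is an eigenvector for \<open>z\<close>.\<close>

lemma eigenvalue_of_square:
  fixes A :: "real^'n^'n"
  assumes w: "w \<noteq> 0" and eq: "A *v (A *v w) = - k *\<^sub>R w" and "0 \<le> k"
  shows "\<exists>z. Re z = 0 \<and> eigenvalue (cmatrix A) z"
proof -
  define z where "z = \<i> * complex_of_real (sqrt k)"
  have z2: "z * z = - of_real k" using \<open>0 \<le> k\<close>
    by (simp add: z_def algebra_simps of_real_mult[symmetric] del: of_real_mult)
  define v where "v = cvector (A *v w) + z *s cvector w"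
  have cw: "cvector w \<noteq> 0" using w by (auto simp: cvector_def vec_eq_iff)
  show ?thesis
  proof (cases "v = 0")
    case True
    then have "cmatrix A *v cvector w = (- z) *s cvector w"
      by (simp add: v_def cmatrix_mult_cvector eq_neg_iff_add_eq_0)
    then show ?thesis using cw by (intro exI[of _ "- z"]) (auto simp: eigenvalue_def z_def)
  next
    case False
    have "cmatrix A *v v = cvector (A *v (A *v w)) + z *s cvector (A *v w)"
      by (simp add: v_def matrix_vector_right_distrib cmatrix_mult_cvector vector_scalar_commute)
    also have "\<dots> = z *s v"
      using z2 by (simp add: v_def eq cvector_def vec_eq_iff algebra_simps)
    finally show ?thesis using False by (intro exI[of _ z]) (auto simp: eigenvalue_def z_def)
  qed
qed

text \<open>On the range of \<open>Z\<close> the matrix \<open>A\<close> is skew for the form given by \<open>Z\<close>; a maximiser \<open>v\<close> of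
  \<open>(A x) \<bullet> Z (A x)\<close> relative to \<open>x \<bullet> Z x\<close> yields \<open>A\<^sup>T A\<^sup>T (Z v) = - k Z v\<close> with \<open>k \<ge> 0\<close>.\<close>

lemma imaginary_eigenvalue_of_lyapunov_kernel:
  fixes A Z :: "real^'n^'n"
  assumes sym: "transpose Z = Z" and nonneg: "\<And>x. 0 \<le> x \<bullet> (Z *v x)" and "Z \<noteq> 0"
    and lyap: "lyapunov A Z = 0"
  shows "\<exists>z. Re z = 0 \<and> eigenvalue (cmatrix A) z"
proof -
  have skew: "transpose A *v (Z *v x) = - (Z *v (A *v x))" for x
  proof -
    have "(transpose A ** Z + Z ** A) *v x = 0" using lyap by (simp add: lyapunov_def)
    then show ?thesis
      by (simp only: matrix_vector_mult_add_rdistrib matrix_vector_mul_assoc eq_neg_iff_add_eq_0)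
  qed
  have adj: "(transpose A *v x) \<bullet> y = x \<bullet> (A *v y)" for x y
    by (simp add: dot_lmul_matrix)
  note sd = sym_matrix_dot[OF sym]
  define N where "N = range ((*v) Z)"
  have sub: "subspace N" unfolding N_def by (intro linear_subspace_image) (auto simp: matrix_vector_mul_linear)
  \<comment> \<open>A zero of a semidefinite form lies in the kernel, and the kernel of a symmetric
    matrix meets its range only in 0.\<close>
  have pos: "0 < x \<bullet> (Z *v x)" if "x \<in> N" "x \<noteq> 0" for x
  proof (rule ccontr)
    assume neg: "\<not> ?thesis"
    note x = \<open>x \<in> N\<close> \<open>x \<noteq> 0\<close>
    have "x \<bullet> (Z *v x) = 0" using neg nonneg[of x] by linarith
    then have "(Z *v x) \<bullet> y = 0" for y
      using psd_form_zero[OF bilinear_matrix[of Z], of x y] sd nonneg by (simp add: inner_commute)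
    moreover obtain y where "x = Z *v y" using x(1) unfolding N_def by blast
    ultimately have "x \<bullet> x = 0" by (simp add: sd)
    then show False using x by simp
  qed
  define T where "T = sphere 0 1 \<inter> N"
  have "compact T" unfolding T_def
    by (intro compact_Int_closed compact_sphere closed_subspace sub)
  obtain y0 where "Z *v y0 \<noteq> 0" using \<open>Z \<noteq> 0\<close> by (auto simp: matrix_eq)
  then have "(1 / norm (Z *v y0)) *\<^sub>R (Z *v y0) \<in> T"
    unfolding T_def using subspace_scale[OF sub, of "Z *v y0"] by (auto simp: N_def)
  then have "T \<noteq> {}" by blast
  define b where "b = (\<lambda>x. (A *v x) \<bullet> (Z *v (A *v x)))"
  have "continuous_on T (\<lambda>x. b x / (x \<bullet> (Z *v x)))" unfolding b_def
  proof (intro continuous_intros linear_continuous_on matrix_vector_mul_bounded_linear ballI)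
    show "bounded_linear (\<lambda>x. Z *v (A *v x))"
      by (simp add: matrix_vector_mul_assoc matrix_vector_mul_bounded_linear)
    show "x \<bullet> (Z *v x) \<noteq> 0" if "x \<in> T" for x
    proof -
      have "x \<noteq> 0" "x \<in> N" using that by (auto simp: T_def)
      then show ?thesis using pos by force
    qed
  qed
  then obtain v where v: "v \<in> T" "\<And>x. x \<in> T \<Longrightarrow> b x / (x \<bullet> (Z *v x)) \<le> b v / (v \<bullet> (Z *v v))"
    using continuous_attains_sup[OF \<open>compact T\<close> \<open>T \<noteq> {}\<close>] by blast
  have vN: "v \<in> N" "v \<noteq> 0" using v(1) by (auto simp: T_def)
  define k where "k = b v / (v \<bullet> (Z *v v))"
  have "0 \<le> k" unfolding k_def b_def by (intro divide_nonneg_nonneg nonneg)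
  \<comment> \<open>Extension from \<open>N\<close> to all vectors: the component orthogonal to the
    range of \<open>Z\<close> lies in the kernel of \<open>Z\<close>, which \<open>A\<close>
    preserves by \<open>skew\<close>, so neither side of the inequality sees it.\<close>
  have le: "b y \<le> k * (y \<bullet> (Z *v y))" for y
  proof -
    obtain x u where y: "y = x + u" and x: "x \<in> N" and u: "\<And>w. w \<in> N \<Longrightarrow> orthogonal u w"
      using orthogonal_subspace_decomp_exists[of N y] by (metis span_eq_iff sub)
    have "(Z *v u) \<bullet> w = 0" for w using u[of "Z *v w"] by (simp add: sd orthogonal_def N_def)
    then have Zu: "Z *v u = 0" by (metis inner_eq_zero_iff)
    then have ZAu: "Z *v (A *v u) = 0" using skew[of u] by simp
    have "b y = b x" using ZAu sd[of "A *v u" "A *v x"]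
      by (simp add: b_def y matrix_vector_right_distrib inner_simps)
    moreover have "y \<bullet> (Z *v y) = x \<bullet> (Z *v x)" using Zu sd[of u x]
      by (simp add: y matrix_vector_right_distrib inner_simps)
    moreover have "b x \<le> k * (x \<bullet> (Z *v x))"
    proof (cases "x = 0")
      case False
      let ?x = "(1 / norm x) *\<^sub>R x"
      have "?x \<in> T" using False subspace_scale[OF sub x] by (simp add: T_def)
      from v(2)[OF this] have "b x / (x \<bullet> (Z *v x)) \<le> k"
        using False by (simp add: k_def b_def matrix_vector_mult_scaleR)
      then show ?thesis using pos[OF x False] by (simp add: field_simps)
    qed (simp add: b_def)
    ultimately show ?thesis by simp
  qed
  \<comment> \<open>The slack in \<open>le\<close>, written as a form: semidefinite everywhere and
    zero at the maximiser, so \<open>v\<close> lies in its kernel.\<close>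
  define r where "r = (\<lambda>x y. ((k *\<^sub>R Z - transpose A ** Z ** A) *v x) \<bullet> y)"
  have r: "r x y = k * (x \<bullet> (Z *v y)) - (A *v x) \<bullet> (Z *v (A *v y))" for x y
    by (simp add: r_def matrix_vector_mult_diff_rdistrib scaleR_matrix_vector_assoc[symmetric] inner_simps
        matrix_vector_mul_assoc[symmetric] adj sd del: transpose_matrix_vector)
  have "r v y = 0" for y
  proof (rule psd_form_zero[where r=r])
    show "bilinear r" unfolding r_def by (rule bilinear_matrix)
    show "r x y = r y x" for x y unfolding r using sd[of x y] sd[of "A *v x" "A *v y"]
      by (simp add: inner_commute)
    show "0 \<le> r x x" for x using le[of x] by (simp add: r b_def)
    show "r v v = 0" using pos[OF vN] by (simp add: r k_def b_def)
  qed
  then have "(k *\<^sub>R Z - transpose A ** Z ** A) *v v = 0"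
    unfolding r_def by (metis inner_eq_zero_iff)
  then have eq: "transpose A *v (Z *v (A *v v)) = k *\<^sub>R (Z *v v)"
    by (simp add: matrix_vector_mult_diff_rdistrib scaleR_matrix_vector_assoc[symmetric]
        matrix_vector_mul_assoc[symmetric] del: transpose_matrix_vector)
  have "transpose A *v (transpose A *v (Z *v v)) = - k *\<^sub>R (Z *v v)"
    unfolding skew using linear_neg[OF matrix_vector_mul_linear, of "transpose A"]
    by (simp add: eq del: transpose_matrix_vector)
  moreover have "Z *v v \<noteq> 0" using pos[OF vN] by auto
  ultimately obtain z where z: "Re z = 0" "eigenvalue (cmatrix (transpose A)) z"
    using eigenvalue_of_square[of "Z *v v" "transpose A" k] \<open>0 \<le> k\<close> by blast
  have "cmatrix (transpose A) = transpose (cmatrix A)"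
    by (simp add: cmatrix_def transpose_def vec_eq_iff)
  then show ?thesis using z eigenvalue_transpose by metis
qed

section \<open>Lyapunov's theorem by continuation in the shift\<close>

lemma lyapunov_stable_shift_mono:
  assumes "lyapunov_stable (A - s *\<^sub>R mat 1)" "s \<le> t"
  shows "lyapunov_stable (A - t *\<^sub>R mat 1)"
proof -
  obtain P where P: "transpose P = P" "\<And>x. x \<noteq> 0 \<Longrightarrow> 0 < x \<bullet> (P *v x)"
      "\<And>x. x \<noteq> 0 \<Longrightarrow> x \<bullet> (P *v ((A - s *\<^sub>R mat 1) *v x)) < 0"
    using assms(1) unfolding lyapunov_stable_def by blast
  have "x \<bullet> (P *v ((A - t *\<^sub>R mat 1) *v x)) < 0" if "x \<noteq> 0" for x
  proof -
    have "x \<bullet> (P *v ((A - t *\<^sub>R mat 1) *v x)) = x \<bullet> (P *v ((A - s *\<^sub>R mat 1) *v x)) - (t - s) * (x \<bullet> (P *v x))"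
      by (simp add: algebra_simps inner_simps)
    moreover have "0 \<le> (t - s) * (x \<bullet> (P *v x))" using P(2)[OF that] assms(2) by simp
    ultimately show ?thesis using P(3)[OF that] by linarith
  qed
  with P show ?thesis unfolding lyapunov_stable_def by blast
qed

text \<open>The same \<open>P\<close> still works for a slightly smaller shift. Strict negativity
  has a margin \<open>d\<close> on the unit sphere, reducing the shift by \<open>e\<close> costs at
  most \<open>e * (x \<bullet> P x)\<close>, and \<open>e = d / K\<close> stays within the margin
  because \<open>K\<close> strictly exceeds the norm of \<open>P\<close>.\<close>

lemma lyapunov_stable_shift_open:
  assumes "lyapunov_stable (A - s *\<^sub>R mat 1)"
  obtains e where "e > 0" "lyapunov_stable (A - (s - e) *\<^sub>R mat 1)"
proof -
  obtain P where P: "transpose P = P" "\<And>x. x \<noteq> 0 \<Longrightarrow> 0 < x \<bullet> (P *v x)"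
      "\<And>x. x \<noteq> 0 \<Longrightarrow> x \<bullet> (P *v ((A - s *\<^sub>R mat 1) *v x)) < 0"
    using assms(1) unfolding lyapunov_stable_def by blast
  then have "x \<noteq> 0 \<Longrightarrow> x \<bullet> ((P ** (A - s *\<^sub>R mat 1)) *v x) < 0" for x
    by (simp add: matrix_vector_mul_assoc)
  then obtain d where d: "d > 0" "\<And>x. x \<bullet> ((P ** (A - s *\<^sub>R mat 1)) *v x) \<le> - d * (x \<bullet> x)"
    using quadratic_form_upper_bound by metis
  define K where "K = onorm ((*v) P) + 1"
  have K: "K > 0" using onorm_pos_le[OF matrix_vector_mul_bounded_linear, of P] by (simp add: K_def)
  have Px: "x \<bullet> (P *v x) < K * (x \<bullet> x)" if "x \<noteq> 0" for x
  proof -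
    have "x \<bullet> (P *v x) \<le> norm x * norm (P *v x)" by (rule norm_cauchy_schwarz)
    also have "\<dots> \<le> norm x * (onorm ((*v) P) * norm x)"
      by (intro mult_left_mono onorm matrix_vector_mul_bounded_linear) simp
    also have "\<dots> = onorm ((*v) P) * (x \<bullet> x)" by (simp add: power2_norm_eq_inner[symmetric] power2_eq_square)
    also have "\<dots> < K * (x \<bullet> x)" using that by (simp add: K_def)
    finally show ?thesis .
  qed
  show ?thesis
  proof
    show "d / K > 0" using d K by simp
    have "x \<bullet> (P *v ((A - (s - d / K) *\<^sub>R mat 1) *v x)) < 0" if "x \<noteq> 0" for x
    proof -
      have "x \<bullet> (P *v ((A - (s - d / K) *\<^sub>R mat 1) *v x))
          = x \<bullet> ((P ** (A - s *\<^sub>R mat 1)) *v x) + d / K * (x \<bullet> (P *v x))"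
        by (simp add: matrix_vector_mul_assoc[symmetric] algebra_simps inner_simps)
      also have "\<dots> < - d * (x \<bullet> x) + d / K * (K * (x \<bullet> x))"
        using d K Px[OF that] by (intro add_le_less_mono d(2) mult_strict_left_mono) auto
      also have "\<dots> = 0" using K by simp
      finally show ?thesis .
    qed
    with P show "lyapunov_stable (A - (s - d / K) *\<^sub>R mat 1)" unfolding lyapunov_stable_def by blast
  qed
qed

lemma lyapunov_stable_shift_large:
  fixes A :: "real^'n^'n"
  shows "lyapunov_stable (A - (onorm ((*v) A) + 1) *\<^sub>R mat 1)"
  unfolding lyapunov_stable_def
proof (intro exI[of _ "mat 1"] conjI allI impI)
  fix x :: "real^'n" assume "x \<noteq> 0"
  have "x \<bullet> (A *v x) \<le> norm x * norm (A *v x)" by (rule norm_cauchy_schwarz)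
  also have "\<dots> \<le> norm x * (onorm ((*v) A) * norm x)"
    by (intro mult_left_mono onorm matrix_vector_mul_bounded_linear) simp
  also have "\<dots> = onorm ((*v) A) * (x \<bullet> x)" by (simp add: power2_norm_eq_inner[symmetric] power2_eq_square)
  finally have "x \<bullet> (A *v x) - (onorm ((*v) A) + 1) * (x \<bullet> x) < 0"
    using iffD2[OF inner_gt_zero_iff \<open>x \<noteq> 0\<close>] unfolding distrib_right by linarith
  then show "x \<bullet> (mat 1 *v ((A - (onorm ((*v) A) + 1) *\<^sub>R mat 1) *v x)) < 0"
    by (simp add: matrix_vector_mult_diff_rdistrib inner_simps)
qed auto

text \<open>If \<open>A\<close> had no certificate, the shifts \<open>A - s I\<close> that have one
  would form an open up-set with infimum \<open>t \<ge> 0\<close>, not attained. Solve the Lyapunov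
  equation with right-hand side \<open>- I\<close> at shifts tending to \<open>t\<close>. If the
  solutions do not blow up, a rescaled limit is a certificate at \<open>t\<close>. If they do, the
  normalised limit lies in the kernel of the Lyapunov operator and forces an eigenvalue of
  \<open>A\<close> with real part \<open>t\<close>. Both are impossible.\<close>

lemma hurwitz_imp_lyapunov_stable:
  fixes A :: "real^'n^'n"
  assumes "hurwitz A"
  shows "lyapunov_stable A"
proof (rule ccontr)
  assume unstable: "\<not> lyapunov_stable A"
  define F where "F = (\<lambda>s. A - s *\<^sub>R mat 1)"
  define S where "S = {s. lyapunov_stable (F s)}"
  have "F 0 = A" by (simp add: F_def)
  have pos: "0 < s" if "s \<in> S" for s
    using lyapunov_stable_shift_mono[of A s 0] that unstable by (fastforce simp: S_def F_def not_le)
  have "S \<noteq> {}" using lyapunov_stable_shift_large[of A] by (auto simp: S_def F_def)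
  have bdd: "bdd_below S" using pos by (meson bdd_belowI less_imp_le)
  define t where "t = Inf S"
  have "0 \<le> t" unfolding t_def using \<open>S \<noteq> {}\<close> pos by (intro cInf_greatest) (auto simp: less_imp_le)
  have tS: "t \<notin> S"
  proof
    assume "t \<in> S"
    then obtain e where "e > 0" "t - e \<in> S"
      using lyapunov_stable_shift_open[of A t] by (auto simp: S_def F_def)
    then show False using cInf_lower[OF _ bdd, of "t - e"] by (simp add: t_def)
  qed
  have "\<exists>s\<in>S. s < t + 1 / real (Suc k)" for k
    using cInf_lessD[OF \<open>S \<noteq> {}\<close>, of "t + 1 / real (Suc k)"] by (simp add: t_def)
  then obtain s where s: "\<And>k. s k \<in> S" "\<And>k. s k < t + 1 / real (Suc k)" by metis
  have st: "t \<le> s k" for k unfolding t_def by (rule cInf_lower[OF s(1) bdd])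
  have "s \<longlonglongrightarrow> t"
  proof (rule tendsto_sandwich[OF _ _ tendsto_const])
    show "(\<lambda>k. t + 1 / real (Suc k)) \<longlonglongrightarrow> t"
      using tendsto_add[OF tendsto_const[of t] LIMSEQ_Suc[OF lim_1_over_n]] by simp
    show "\<forall>\<^sub>F k in sequentially. t \<le> s k" "\<forall>\<^sub>F k in sequentially. s k \<le> t + 1 / real (Suc k)"
      by (intro always_eventually allI st less_imp_le s(2))+
  qed
  define P where "P = (\<lambda>k. inv (lyapunov (F (s k))) (- mat 1))"
  have stable: "lyapunov_stable (F (s k))" for k using s(1) by (simp add: S_def)
  have Psym: "transpose (P k) = P k" for k unfolding P_def
    by (intro transpose_inv_lyapunov stable) (simp add: transpose_uminus)
  have Peq: "x \<bullet> (P k *v (F (s k) *v x)) = - (x \<bullet> x) / 2" for x k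
    using lyapunov_diag[OF Psym, of x "F (s k)" k] inv_lyapunov(1)[OF stable, of k "- mat 1"]
    by (simp add: P_def uminus_matrix_vector_mult)
  have Pnn: "0 \<le> x \<bullet> (P k *v x)" for x k
    by (rule lyapunov_stable_nonneg[OF stable[of k] Psym]) (simp add: Peq)
  have P0: "P k \<noteq> 0" for k using Peq[of "axis undefined 1" k] by auto
  \<comment> \<open>Normalising gives a convergent subsequence whether or not the \<open>P k\<close>
    stay bounded.\<close>
  define Z where "Z = (\<lambda>k. (1 / norm (P k)) *\<^sub>R P k)"
  have "Z k \<in> sphere 0 1" for k using P0 by (simp add: Z_def)
  then obtain Z0 r where Z0: "Z0 \<in> sphere 0 1" and r: "strict_mono r" "(Z \<circ> r) \<longlonglongrightarrow> Z0"
    using compact_sphere[unfolded compact_def, rule_format, of Z 0 1] by blast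
  have sr: "(\<lambda>k. s (r k)) \<longlonglongrightarrow> t" using LIMSEQ_subseq_LIMSEQ[OF \<open>s \<longlonglongrightarrow> t\<close> r(1)] by (simp add: o_def)
  have Zr: "(\<lambda>k. Z (r k)) \<longlonglongrightarrow> Z0" using r(2) by (simp add: o_def)
  have Zx: "(\<lambda>k. x \<bullet> (Z (r k) *v x)) \<longlonglongrightarrow> x \<bullet> (Z0 *v x)" for x
    by (intro tendsto_intros tendsto_matrix_vector_mult Zr)
  have Zsym: "transpose Z0 = Z0"
  proof -
    have "(\<lambda>k. Z (r k) $ i $ j) \<longlonglongrightarrow> Z0 $ i $ j" for i j by (intro tendsto_intros Zr)
    moreover have "Z (r k) $ i $ j = Z (r k) $ j $ i" for k i j
      using Psym[of "r k"] by (simp add: Z_def transpose_def vec_eq_iff)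
    ultimately have "Z0 $ i $ j = Z0 $ j $ i" for i j
      using LIMSEQ_unique by (metis (no_types, lifting) ext)
    then show ?thesis by (simp add: transpose_def vec_eq_iff)
  qed
  have Znn: "0 \<le> x \<bullet> (Z0 *v x)" for x
    by (rule LIMSEQ_le_const[OF Zx]) (auto simp: Z_def scaleR_matrix_vector_assoc[symmetric] Pnn)
  have lim: "(\<lambda>k. - (x \<bullet> x) / 2 * (1 / norm (P (r k)))) \<longlonglongrightarrow> x \<bullet> (Z0 *v (F t *v x))" for x
  proof -
    have "(\<lambda>k. x \<bullet> (Z (r k) *v (F (s (r k)) *v x))) \<longlonglongrightarrow> x \<bullet> (Z0 *v (F t *v x))"
      unfolding F_def by (intro tendsto_intros tendsto_matrix_vector_mult Zr sr)
    then show ?thesis by (simp add: Z_def scaleR_matrix_vector_assoc[symmetric] Peq mult.commute)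
  qed
  define e where "e = (axis undefined 1 :: real^'n)"
  have ee: "e \<bullet> e = 1" by (simp add: e_def inner_axis_axis)
  \<comment> \<open>\<open>m\<close> is the limit of \<open>1 / norm (P (r k))\<close>, read off
    from the limit equation at a unit vector. Blow-up is the case \<open>m = 0\<close>.\<close>
  define m where "m = - 2 * (e \<bullet> (Z0 *v (F t *v e)))"
  have mlim: "(\<lambda>k. 1 / norm (P (r k))) \<longlonglongrightarrow> m"
    using tendsto_mult_left[OF lim[of e], of "- 2"] by (simp add: ee m_def)
  have "0 \<le> m" by (rule LIMSEQ_le_const[OF mlim]) auto
  have Zeq: "x \<bullet> (Z0 *v (F t *v x)) = - (x \<bullet> x) / 2 * m" for x
    by (rule LIMSEQ_unique[OF lim tendsto_mult[OF tendsto_const mlim]])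
  show False
  proof (cases "m = 0")
    case True
    have "lyapunov (F t) Z0 = 0"
    proof (rule sym_matrix_eq_dot)
      show "transpose (lyapunov (F t) Z0) = lyapunov (F t) Z0"
        by (simp add: transpose_lyapunov Zsym)
      show "transpose 0 = (0 :: real^'n^'n)" by (simp add: transpose_def vec_eq_iff)
      show "x \<bullet> (lyapunov (F t) Z0 *v x) = x \<bullet> (0 *v x)" for x
        using Zeq[of x] True by (simp add: lyapunov_diag[OF Zsym])
    qed
    moreover have "Z0 \<noteq> 0" using Z0 by auto
    ultimately obtain z where z: "Re z = 0" "eigenvalue (cmatrix (F t)) z"
      using imaginary_eigenvalue_of_lyapunov_kernel[OF Zsym Znn] by blast
    have "cmatrix (F t) = cmatrix A - mat (complex_of_real t)"
      by (simp add: cmatrix_def F_def mat_def vec_eq_iff)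
    with z have "eigenvalue (cmatrix A) (z + complex_of_real t)" by (simp add: eigenvalue_diff_mat)
    then have "Re (z + complex_of_real t) < 0" using assms unfolding hurwitz_def by blast
    then show False using z(1) \<open>0 \<le> t\<close> by simp
  next
    case False
    have "0 < x \<bullet> (Z0 *v x)" if "x \<noteq> 0" for x
    proof (rule ccontr)
      assume "\<not> ?thesis"
      then have "x \<bullet> (Z0 *v x) = 0" using Znn[of x] by linarith
      then have "(Z0 *v x) \<bullet> y = 0" for y
        using psd_form_zero[OF bilinear_matrix[of Z0], of x y] sym_matrix_dot[OF Zsym] Znn by (simp add: inner_commute)
      then have "x \<bullet> (Z0 *v (F t *v x)) = 0" by (simp add: sym_matrix_dot[OF Zsym])
      then show False using Zeq[of x] that False by simp
    qed
    moreover have "x \<bullet> (Z0 *v (F t *v x)) < 0" if "x \<noteq> 0" for x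
      using Zeq[of x] that False \<open>0 \<le> m\<close> inner_gt_zero_iff[of x] by simp
    ultimately have "lyapunov_stable (F t)" using Zsym unfolding lyapunov_stable_def by blast
    then show False using tS by (simp add: S_def)
  qed
qed

section \<open>Riccati equation and spectral factorisation\<close>

lemma transpose_dot: "(transpose Y *v x) \<bullet> y = x \<bullet> (Y *v y)" for Y :: "real^'n^'m"
  by (simp add: dot_lmul_matrix)

text \<open>If \<open>P\<close> is a Lyapunov certificate for \<open>A - H G\<close>, then \<open>P + c X\<close> is one for \<open>A\<close> once \<open>c\<close> is
  large: the cross term \<open>x \<bullet> P H (G x)\<close> is absorbed by the dissipation of \<open>X\<close>.\<close>

lemma lyapunov_stable_of_detectable:
  fixes A :: "real^'n^'n" and H :: "real^'m^'n" and G :: "real^'n^'m"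
  assumes "lyapunov_stable (A - H ** G)" and X: "transpose X = X" "\<And>x. 0 \<le> x \<bullet> (X *v x)"
    and diss: "\<And>x. 2 * (x \<bullet> (X *v (A *v x))) \<le> - (norm (G *v x))\<^sup>2"
  shows "lyapunov_stable A"
proof -
  obtain P where P: "transpose P = P" "\<And>x. x \<noteq> 0 \<Longrightarrow> 0 < x \<bullet> (P *v x)"
      "\<And>x. x \<noteq> 0 \<Longrightarrow> x \<bullet> (P *v ((A - H ** G) *v x)) < 0"
    using assms(1) unfolding lyapunov_stable_def by blast
  then have "x \<noteq> 0 \<Longrightarrow> x \<bullet> ((P ** (A - H ** G)) *v x) < 0" for x
    by (simp add: matrix_vector_mul_assoc)
  then obtain d where d: "d > 0" "\<And>x. x \<bullet> ((P ** (A - H ** G)) *v x) \<le> - d * (x \<bullet> x)"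
    using quadratic_form_upper_bound by metis
  define b where "b = onorm ((*v) (P ** H))"
  \<comment> \<open>The value for which Young's inequality balances the cross term: half of the
    margin \<open>d\<close> is spent on \<open>x\<close>, and \<open>c / 2\<close> times the squared
    output is exactly what \<open>c X\<close> dissipates.\<close>
  define c where "c = b\<^sup>2 / d"
  have "0 \<le> c" using d by (simp add: c_def)
  have neg: "x \<bullet> ((P + c *\<^sub>R X) *v (A *v x)) < 0" if "x \<noteq> 0" for x
  proof -
    let ?g = "norm (G *v x)"
    have "x \<bullet> ((P ** H) *v (G *v x)) \<le> norm x * norm ((P ** H) *v (G *v x))" by (rule norm_cauchy_schwarz)
    also have "\<dots> \<le> norm x * (b * ?g)" unfolding b_def
      by (intro mult_left_mono onorm matrix_vector_mul_bounded_linear) simp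
    also have "\<dots> \<le> d / 2 * (norm x)\<^sup>2 + c / 2 * ?g\<^sup>2"
    proof -
      have "0 \<le> (d * norm x - b * ?g)\<^sup>2 / (2 * d)" using d by simp
      also have "\<dots> = d / 2 * (norm x)\<^sup>2 + c / 2 * ?g\<^sup>2 - norm x * (b * ?g)"
        using d(1) by (simp add: c_def power2_eq_square field_simps)
      finally show ?thesis by simp
    qed
    finally have cross: "x \<bullet> ((P ** H) *v (G *v x)) \<le> d / 2 * (x \<bullet> x) + c / 2 * ?g\<^sup>2"
      by (simp add: power2_norm_eq_inner)
    have "x \<bullet> ((P + c *\<^sub>R X) *v (A *v x))
        = x \<bullet> ((P ** (A - H ** G)) *v x) + x \<bullet> ((P ** H) *v (G *v x)) + c / 2 * (2 * (x \<bullet> (X *v (A *v x))))"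
      by (simp add: matrix_vector_mul_assoc[symmetric] scaleR_matrix_vector_assoc[symmetric]
          matrix_vector_mult_add_rdistrib matrix_vector_mult_diff_rdistrib matrix_vector_mult_diff_distrib inner_simps)
    also have "\<dots> \<le> - d * (x \<bullet> x) + (d / 2 * (x \<bullet> x) + c / 2 * ?g\<^sup>2) + c / 2 * (- ?g\<^sup>2)"
      using \<open>0 \<le> c\<close> by (intro add_mono d(2) cross mult_left_mono diss) simp
    also have "\<dots> = - (d / 2) * (x \<bullet> x)" by (simp add: field_simps)
    also have "\<dots> < 0" using d(1) that by (simp add: mult_pos_pos)
    finally show ?thesis .
  qed
  have "0 < x \<bullet> ((P + c *\<^sub>R X) *v x)" if "x \<noteq> 0" for x
    using P(2)[OF that] mult_nonneg_nonneg[OF \<open>0 \<le> c\<close> X(2)[of x]]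
    by (simp add: matrix_vector_mult_add_rdistrib scaleR_matrix_vector_assoc[symmetric] inner_simps)
  moreover have "transpose (P + c *\<^sub>R X) = P + c *\<^sub>R X"
    by (simp add: transpose_add transpose_scalar P X)
  ultimately show ?thesis using neg unfolding lyapunov_stable_def by blast
qed

lemma sym_matrix_component:
  fixes X :: "real^'n^'n"
  assumes "transpose X = X"
  shows "X $ i $ j = ((axis i 1 + axis j 1) \<bullet> (X *v (axis i 1 + axis j 1))
      - axis i 1 \<bullet> (X *v axis i 1) - axis j 1 \<bullet> (X *v axis j 1)) / 2"
    and "X $ i $ j = ((axis i 1 + axis j 1) \<bullet> (X *v (axis i 1 + axis j 1))
      - (axis i 1 - axis j 1) \<bullet> (X *v (axis i 1 - axis j 1))) / 4"
proof -
  have "axis i 1 \<bullet> (X *v axis j 1) = X $ i $ j" for i j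
    by (simp add: matrix_vector_mult_basis column_def inner_axis')
  moreover have "X $ j $ i = X $ i $ j" for i j using assms by (metis transpose_def vec_lambda_beta)
  ultimately show "X $ i $ j = ((axis i 1 + axis j 1) \<bullet> (X *v (axis i 1 + axis j 1))
      - axis i 1 \<bullet> (X *v axis i 1) - axis j 1 \<bullet> (X *v axis j 1)) / 2"
    "X $ i $ j = ((axis i 1 + axis j 1) \<bullet> (X *v (axis i 1 + axis j 1))
      - (axis i 1 - axis j 1) \<bullet> (X *v (axis i 1 - axis j 1))) / 4"
    by (simp_all add: matrix_vector_right_distrib matrix_vector_mult_diff_distrib inner_simps)
qed

text \<open>At each vector the form values increase and are bounded, and polarisation carries their
  convergence over to the entries.\<close>

lemma sym_matrix_incseq_convergent:
  fixes X :: "nat \<Rightarrow> real^'n^'n"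
  assumes sym: "\<And>k. transpose (X k) = X k"
    and mono: "\<And>k x. x \<bullet> (X k *v x) \<le> x \<bullet> (X (Suc k) *v x)"
    and bdd: "\<And>k x. x \<bullet> (X k *v x) \<le> x \<bullet> (Q *v x)"
  obtains Y where "X \<longlonglongrightarrow> Y"
proof -
  have "\<exists>y. (\<lambda>k. x \<bullet> (X k *v x)) \<longlonglongrightarrow> y" for x
    using incseq_convergent[of "\<lambda>k. x \<bullet> (X k *v x)"] mono bdd by (metis incseq_SucI)
  then obtain f where f: "\<And>x. (\<lambda>k. x \<bullet> (X k *v x)) \<longlonglongrightarrow> f x" by metis
  have "X \<longlonglongrightarrow> (\<chi> i j. (f (axis i 1 + axis j 1) - f (axis i 1) - f (axis j 1)) / 2)"
    by (intro vec_tendstoI) (simp add: sym_matrix_component(1)[OF sym] tendsto_intros f)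
  then show thesis by (rule that)
qed

section \<open>Newton's method for the Riccati equation\<close>

lemma tendsto_transpose:
  fixes X :: "'a \<Rightarrow> real^'n^'m"
  assumes "(X \<longlongrightarrow> Y) F"
  shows "((\<lambda>k. transpose (X k)) \<longlongrightarrow> transpose Y) F"
  unfolding transpose_def by (intro tendsto_vec_lambda tendsto_intros assms)

lemma bounded_bilinear_matrix_matrix_mult:
  "bounded_bilinear (\<lambda>(X :: real^'n^'m) (Y :: real^'p^'n). X ** Y)"
  unfolding bilinear_conv_bounded_bilinear[symmetric] bilinear_def
  by (auto intro!: linearI simp: matrix_add_ldistrib scalar_matrix_assoc matrix_scalar_ac)
     (simp_all add: matrix_matrix_mult_def vec_eq_iff distrib_right sum.distrib)

lemmas tendsto_matrix_matrix_mult = bounded_bilinear.tendsto[OF bounded_bilinear_matrix_matrix_mult]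

text \<open>The setting for an invertible square root, whose inverse is supplied as
  \<open>N\<close>. The assumption \<open>feasible\<close> is the Riccati inequality obtained from
  the dissipation inequality by choosing the worst input \<open>u\<close> for each
  \<open>x\<close>.\<close>

locale kyp =
  fixes A :: "real^'n^'n" and B :: "real^'m^'n" and C :: "real^'n^'m" and N :: "real^'m^'m" and Q :: "real^'n^'n"
  assumes stable: "lyapunov_stable A" and N_sym: "transpose N = N" and Q_sym: "transpose Q = Q"
    and feasible: "2 * (x \<bullet> (Q *v (A *v x))) + (norm (N *v (C *v x - transpose B *v (Q *v x))))\<^sup>2 \<le> 0"
begin

text \<open>With \<open>N\<close> inverse to \<open>M\<close>, this solves
  \<open>M ** transpose L = C - transpose B ** X\<close> for \<open>transpose L\<close>: the gain of
  a Riccati solution is the transposed spectral factor.\<close>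

definition gain :: "real^'n^'n \<Rightarrow> real^'n^'m" where
  "gain X = N ** (C - transpose B ** X)"

definition closed_loop :: "real^'n^'m \<Rightarrow> real^'n^'n" where
  "closed_loop J = A - (B ** N) ** J"

lemma gain_apply: "gain X *v x = N *v (C *v x - transpose B *v (X *v x))"
  by (simp add: gain_def matrix_vector_mul_assoc[symmetric] matrix_vector_mult_diff_rdistrib del: transpose_matrix_vector)

lemma closed_loop_apply: "closed_loop J *v x = A *v x - B *v (N *v (J *v x))"
  by (simp add: closed_loop_def matrix_vector_mul_assoc[symmetric] matrix_vector_mult_diff_rdistrib)

text \<open>Completion of the square: the Riccati residual is the minimum over \<open>J\<close> of the residuals of
  the Lyapunov equations of the closed loops.\<close>

lemma residual_eq:
  assumes "transpose X = X"
  shows "(norm (J *v x))\<^sup>2 - 2 * ((N *v (J *v x)) \<bullet> (C *v x)) - 2 * (x \<bullet> (X *v (closed_loop J *v x)))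
     = (norm (J *v x - gain X *v x))\<^sup>2 - 2 * (x \<bullet> (X *v (A *v x))) - (norm (gain X *v x))\<^sup>2"
proof -
  have "(J *v x) \<bullet> (gain X *v x) = (N *v (J *v x)) \<bullet> (C *v x) - (N *v (J *v x)) \<bullet> (transpose B *v (X *v x))"
    unfolding gain_apply by (simp only: sym_matrix_dot[OF N_sym, symmetric] inner_diff_right)
  also have "(N *v (J *v x)) \<bullet> (transpose B *v (X *v x)) = x \<bullet> (X *v (B *v (N *v (J *v x))))"
    unfolding inner_commute[of "N *v (J *v x)"] transpose_dot sym_matrix_dot[OF assms] ..
  finally have cross: "(J *v x) \<bullet> (gain X *v x) = (N *v (J *v x)) \<bullet> (C *v x) - x \<bullet> (X *v (B *v (N *v (J *v x))))" .
  have "(norm (J *v x - gain X *v x))\<^sup>2 = (norm (J *v x))\<^sup>2 - 2 * ((J *v x) \<bullet> (gain X *v x)) + (norm (gain X *v x))\<^sup>2"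
    by (simp add: power2_norm_eq_inner inner_diff_left inner_diff_right inner_commute)
  then show ?thesis
    unfolding cross closed_loop_apply matrix_vector_mult_diff_distrib inner_diff_right by simp
qed

lemma residual_nonneg:
  "2 * (x \<bullet> (Q *v (closed_loop J *v x))) \<le> (norm (J *v x))\<^sup>2 - 2 * ((N *v (J *v x)) \<bullet> (C *v x)) - (norm (J *v x - gain Q *v x))\<^sup>2"
  using residual_eq[OF Q_sym, of J x] feasible[of x] by (simp add: gain_apply)

text \<open>Kleinman's form of the Newton step. Linearising \<open>(gain X)\<^sup>T (gain X)\<close>
  at the current gain \<open>J\<close> turns the Riccati equation into a Lyapunov equation for the
  closed loop, with this right-hand side.\<close>

definition newton :: "real^'n^'m \<Rightarrow> real^'n^'n" where
  "newton J = inv (lyapunov (closed_loop J)) (transpose J ** J - transpose C ** N ** J - transpose J ** N ** C)"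

lemma newton:
  assumes "lyapunov_stable (closed_loop J)"
  shows "transpose (newton J) = newton J"
    and "2 * (x \<bullet> (newton J *v (closed_loop J *v x))) = (norm (J *v x))\<^sup>2 - 2 * ((N *v (J *v x)) \<bullet> (C *v x))"
proof -
  let ?W = "transpose J ** J - transpose C ** N ** J - transpose J ** N ** C"
  have "transpose ?W = ?W"
    by (simp add: transpose_diff matrix_transpose_mul N_sym matrix_mul_assoc)
  then show sym: "transpose (newton J) = newton J"
    unfolding newton_def by (rule transpose_inv_lyapunov[OF assms])
  have tr: "y \<bullet> (transpose Y *v z) = (Y *v y) \<bullet> z" for y z and Y :: "real^'n^'m"
    unfolding inner_commute[of y] transpose_dot by (rule inner_commute)
  have "2 * (x \<bullet> (newton J *v (closed_loop J *v x))) = x \<bullet> (?W *v x)"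
    using lyapunov_diag[OF sym, of x "closed_loop J"] by (simp add: newton_def inv_lyapunov(1)[OF assms])
  also have "\<dots> = (norm (J *v x))\<^sup>2 - (C *v x) \<bullet> (N *v (J *v x)) - (J *v x) \<bullet> (N *v (C *v x))"
    by (simp add: matrix_vector_mult_diff_rdistrib matrix_vector_mul_assoc[symmetric] inner_simps tr
        power2_norm_eq_inner del: transpose_matrix_vector)
  also have "\<dots> = (norm (J *v x))\<^sup>2 - 2 * ((N *v (J *v x)) \<bullet> (C *v x))"
    using sym_matrix_dot[OF N_sym, of "J *v x" "C *v x"] by (simp add: inner_commute)
  finally show "2 * (x \<bullet> (newton J *v (closed_loop J *v x))) = (norm (J *v x))\<^sup>2 - 2 * ((N *v (J *v x)) \<bullet> (C *v x))" .
qed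

text \<open>The Newton step cancels the linearisation of the Riccati residual, so what is left is
  its purely quadratic part, the square of the change in gain.\<close>

lemma newton_residual:
  assumes "lyapunov_stable (closed_loop J)"
  shows "2 * (x \<bullet> (newton J *v (A *v x))) + (norm (gain (newton J) *v x))\<^sup>2 = (norm (J *v x - gain (newton J) *v x))\<^sup>2"
  using residual_eq[OF newton(1)[OF assms], of J x] newton(2)[OF assms, of x] by simp

text \<open>Along the closed loop, \<open>Q\<close> satisfies as an inequality what
  \<open>newton J\<close> satisfies as an equation, so the comparison principle applies to their
  difference.\<close>

lemma newton_le:
  assumes "lyapunov_stable (closed_loop J)"
  shows "x \<bullet> (newton J *v x) \<le> x \<bullet> (Q *v x)"
proof -
  have "0 \<le> x \<bullet> ((Q - newton J) *v x)"
  proof (rule lyapunov_stable_nonneg[OF assms])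
    show "transpose (Q - newton J) = Q - newton J" by (simp add: transpose_diff Q_sym newton(1)[OF assms])
    show "x \<bullet> ((Q - newton J) *v (closed_loop J *v x)) \<le> 0" for x
      using residual_nonneg[of x J] newton(2)[OF assms, of x] zero_le_power2[of "norm (J *v x - gain Q *v x)"]
    unfolding matrix_vector_mult_diff_rdistrib inner_diff_right diff_self norm_zero power_zero_numeral by linarith
  qed
  then show ?thesis by (simp add: matrix_vector_mult_diff_rdistrib inner_simps)
qed

text \<open>The old and new closed loops differ by a feedback of \<open>J - gain (newton J)\<close>,
  and \<open>Q - newton J\<close> dissipates the square of exactly this output along the new loop.
  Detectability therefore passes the certificate on.\<close>

lemma newton_stable:
  assumes "lyapunov_stable (closed_loop J)"
  shows "lyapunov_stable (closed_loop (gain (newton J)))"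
proof (rule lyapunov_stable_of_detectable)
  let ?J' = "gain (newton J)"
  have "closed_loop ?J' - (B ** N) ** (J - ?J') = closed_loop J"
    by (simp add: matrix_eq matrix_vector_mult_diff_rdistrib closed_loop_apply matrix_vector_mul_assoc[symmetric]
        matrix_vector_mult_diff_distrib)
  then show "lyapunov_stable (closed_loop ?J' - (B ** N) ** (J - ?J'))" using assms by simp
  show "transpose (Q - newton J) = Q - newton J" by (simp add: transpose_diff Q_sym newton(1)[OF assms])
  show "0 \<le> x \<bullet> ((Q - newton J) *v x)" for x
    using newton_le[OF assms, of x] by (simp add: matrix_vector_mult_diff_rdistrib inner_simps)
  show "2 * (x \<bullet> ((Q - newton J) *v (closed_loop ?J' *v x))) \<le> - (norm ((J - ?J') *v x))\<^sup>2" for x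
  proof -
    have "2 * (x \<bullet> (newton J *v (closed_loop ?J' *v x)))
        = (norm (?J' *v x))\<^sup>2 - 2 * ((N *v (?J' *v x)) \<bullet> (C *v x)) + (norm (J *v x - ?J' *v x))\<^sup>2"
      using residual_eq[OF newton(1)[OF assms], of ?J' x] newton_residual[OF assms, of x] by simp
    moreover have "2 * (x \<bullet> (Q *v (closed_loop ?J' *v x))) \<le> (norm (?J' *v x))\<^sup>2 - 2 * ((N *v (?J' *v x)) \<bullet> (C *v x))"
      using residual_nonneg[of x ?J'] zero_le_power2[of "norm (?J' *v x - gain Q *v x)"] by linarith
    ultimately show ?thesis
      unfolding matrix_vector_mult_diff_rdistrib inner_diff_right right_diff_distrib by linarith
  qed
qed

text \<open>Measured along the new closed loop, the two iterates differ in their Lyapunov equations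
  only by the squared change in gain, which has the sign needed for comparison.\<close>

lemma newton_mono:
  assumes "lyapunov_stable (closed_loop J)"
  shows "x \<bullet> (newton J *v x) \<le> x \<bullet> (newton (gain (newton J)) *v x)"
proof -
  let ?J' = "gain (newton J)"
  note st = newton_stable[OF assms]
  have "0 \<le> x \<bullet> ((newton ?J' - newton J) *v x)"
  proof (rule lyapunov_stable_nonneg[OF st])
    show "transpose (newton ?J' - newton J) = newton ?J' - newton J"
      by (simp add: transpose_diff newton(1)[OF assms] newton(1)[OF st])
    show "x \<bullet> ((newton ?J' - newton J) *v (closed_loop ?J' *v x)) \<le> 0" for x
      using newton(2)[OF st, of x] residual_eq[OF newton(1)[OF assms], of ?J' x] newton_residual[OF assms, of x]
        zero_le_power2[of "norm (J *v x - ?J' *v x)"]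
    unfolding matrix_vector_mult_diff_rdistrib inner_diff_right diff_self norm_zero power_zero_numeral by linarith
  qed
  then show ?thesis by (simp add: matrix_vector_mult_diff_rdistrib inner_simps)
qed

lemma riccati_solution:
  obtains X where "transpose X = X" "\<And>x. 0 \<le> x \<bullet> (X *v x)" "\<And>x. x \<bullet> (X *v x) \<le> x \<bullet> (Q *v x)"
    "lyapunov A X = - (transpose (gain X) ** gain X)"
proof -
  define J where "J = rec_nat 0 (\<lambda>_ J. gain (newton J))"
  have J: "J 0 = 0" "J (Suc k) = gain (newton (J k))" for k by (simp_all add: J_def)
  have st: "lyapunov_stable (closed_loop (J k))" for k
  proof (induction k)
    case 0
    have "closed_loop 0 = A" by (simp add: matrix_eq closed_loop_apply)
    then show ?case by (simp add: J stable)
  qed (simp add: J newton_stable)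
  define X where "X = (\<lambda>k. newton (J k))"
  have Xsym: "transpose (X k) = X k" for k by (simp add: X_def newton(1)[OF st])
  have mono: "x \<bullet> (X k *v x) \<le> x \<bullet> (X (Suc k) *v x)" for k x
    using newton_mono[OF st] by (simp add: X_def J)
  have le: "x \<bullet> (X k *v x) \<le> x \<bullet> (Q *v x)" for k x using newton_le[OF st] by (simp add: X_def)
  have nonneg: "0 \<le> x \<bullet> (X k *v x)" for k x
  proof (induction k)
    case 0
    \<comment> \<open>For the zero gain the right-hand side of the Lyapunov equation
      vanishes.\<close>
    show ?case
      by (rule lyapunov_stable_nonneg[OF st[of 0] Xsym]) (use newton(2)[OF st[of 0]] in \<open>simp add: X_def J\<close>)
  qed (use mono in \<open>force intro: order_trans\<close>)
  obtain Y where Y: "X \<longlonglongrightarrow> Y" using sym_matrix_incseq_convergent[of X Q] Xsym mono le by blast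
  have Yx: "(\<lambda>k. x \<bullet> (X k *v x)) \<longlonglongrightarrow> x \<bullet> (Y *v x)" for x
    by (intro tendsto_intros tendsto_matrix_vector_mult Y)
  have "X \<longlonglongrightarrow> transpose Y" using tendsto_transpose[OF Y] by (simp add: Xsym)
  then have Ysym: "transpose Y = Y" by (rule LIMSEQ_unique[OF _ Y])
  have gainY: "(\<lambda>k. gain (X k)) \<longlonglongrightarrow> gain Y" unfolding gain_def
    by (intro tendsto_intros tendsto_matrix_matrix_mult Y)
  then have JY: "(\<lambda>k. J (Suc k)) \<longlonglongrightarrow> gain Y" by (simp add: J X_def)
  have eq: "2 * (x \<bullet> (Y *v (A *v x))) + (norm (gain Y *v x))\<^sup>2 = 0" for x
  proof -
    \<comment> \<open>The residual is the squared difference of consecutive gains, which share a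
      limit. Indices start at \<open>Suc k\<close> because \<open>J 0\<close> is not the gain of an
      earlier iterate.\<close>
    have "(\<lambda>k. 2 * (x \<bullet> (X (Suc k) *v (A *v x))) + (norm (gain (X (Suc k)) *v x))\<^sup>2)
        \<longlonglongrightarrow> 2 * (x \<bullet> (Y *v (A *v x))) + (norm (gain Y *v x))\<^sup>2"
      by (intro tendsto_intros tendsto_matrix_vector_mult LIMSEQ_Suc[OF Y] LIMSEQ_Suc[OF gainY])
    then have lim: "(\<lambda>k. (norm (J (Suc k) *v x - gain (X (Suc k)) *v x))\<^sup>2)
        \<longlonglongrightarrow> 2 * (x \<bullet> (Y *v (A *v x))) + (norm (gain Y *v x))\<^sup>2"
      unfolding X_def newton_residual[OF st] .
    have "(\<lambda>k. (norm (J (Suc k) *v x - gain (X (Suc k)) *v x))\<^sup>2) \<longlonglongrightarrow> (norm (gain Y *v x - gain Y *v x))\<^sup>2"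
      by (intro tendsto_intros tendsto_matrix_vector_mult JY LIMSEQ_Suc[OF gainY])
    from LIMSEQ_unique[OF lim this] show ?thesis by simp
  qed
  show thesis
  proof
    show "transpose Y = Y" by fact
    show "0 \<le> x \<bullet> (Y *v x)" for x by (rule LIMSEQ_le_const[OF Yx]) (simp add: nonneg)
    show "x \<bullet> (Y *v x) \<le> x \<bullet> (Q *v x)" for x by (rule LIMSEQ_le_const2[OF Yx]) (simp add: le)
    show "lyapunov A Y = - (transpose (gain Y) ** gain Y)"
    proof (rule sym_matrix_eq_dot)
      show "transpose (lyapunov A Y) = lyapunov A Y" by (simp add: transpose_lyapunov Ysym)
      show "transpose (- (transpose (gain Y) ** gain Y)) = - (transpose (gain Y) ** gain Y)"
        by (simp add: transpose_uminus matrix_transpose_mul)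
      show "x \<bullet> (lyapunov A Y *v x) = x \<bullet> (- (transpose (gain Y) ** gain Y) *v x)" for x
        using eq[of x] transpose_dot[of "gain Y" "gain Y *v x" x]
        by (simp add: lyapunov_diag[OF Ysym] uminus_matrix_vector_mult matrix_vector_mul_assoc[symmetric]
            power2_norm_eq_inner inner_commute[of x "transpose (gain Y) *v (gain Y *v x)"] del: transpose_matrix_vector)
    qed
  qed
qed

end

section \<open>Spectral factors and the dissipation inequality\<close>

lemma norm_square_le_norm_gram:
  fixes L :: "real^'m^'n"
  shows "(norm L)\<^sup>2 \<le> real CARD('n) * norm (L ** transpose L)"
proof -
  have "(norm L)\<^sup>2 = (\<Sum>i\<in>UNIV. L $ i \<bullet> L $ i)"
    by (simp add: power2_norm_eq_inner inner_vec_def)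
  also have "\<dots> = (\<Sum>i\<in>UNIV. (L ** transpose L) $ i $ i)"
    by (simp add: inner_vec_def matrix_matrix_mult_def transpose_def)
  also have "\<dots> \<le> (\<Sum>i\<in>(UNIV :: 'n set). norm (L ** transpose L))"
  proof (rule sum_mono)
    fix i
    have "\<bar>(L ** transpose L) $ i $ i\<bar> \<le> norm ((L ** transpose L) $ i)" by (rule component_le_norm_cart)
    also have "\<dots> \<le> norm (L ** transpose L)" by (rule Finite_Cartesian_Product.norm_nth_le)
    finally show "(L ** transpose L) $ i $ i \<le> norm (L ** transpose L)" by simp
  qed
  finally show ?thesis by simp
qed

text \<open>Polarisation writes each entry as a difference of two form values, and each of these
  lies between 0 and the corresponding value for \<open>Q\<close>.\<close>

lemma bounded_sym_matrix_interval:
  "bounded {X :: real^'n^'n. transpose X = X \<and> (\<forall>x. 0 \<le> x \<bullet> (X *v x)) \<and> (\<forall>x. x \<bullet> (X *v x) \<le> x \<bullet> (Q *v x))}" (is "bounded ?S")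
proof -
  define q where "q = (\<lambda>x. \<bar>x \<bullet> (Q *v x)\<bar>)"
  define b where "b = (\<lambda>i j. q (axis i 1 + axis j 1) + q (axis i 1 - axis j 1))"
  have entry: "\<bar>X $ i $ j\<bar> \<le> b i j" if X: "X \<in> ?S" for X i j
  proof -
    have "0 \<le> x \<bullet> (X *v x)" "x \<bullet> (X *v x) \<le> q x" for x
      using X abs_ge_self[of "x \<bullet> (Q *v x)"] by (auto simp: q_def intro: order_trans)
    moreover have "\<bar>(a - c) / 4\<bar> \<le> a' + c'" if "0 \<le> a" "a \<le> a'" "0 \<le> c" "c \<le> c'" for a a' c c' :: real
      using that by (simp add: abs_le_iff field_simps)
    ultimately show ?thesis
      unfolding sym_matrix_component(2)[of X i j, OF CollectD[OF X, THEN conjunct1]] b_def by blast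
  qed
  have "norm X \<le> (\<Sum>i\<in>UNIV. \<Sum>j\<in>UNIV. b i j)" if "X \<in> ?S" for X
  proof -
    have "norm X \<le> (\<Sum>i\<in>UNIV. norm (X $ i))" unfolding norm_vec_def by (rule L2_set_le_sum) simp
    also have "\<dots> \<le> (\<Sum>i\<in>UNIV. \<Sum>j\<in>UNIV. \<bar>X $ i $ j\<bar>)" by (intro sum_mono norm_le_l1_cart)
    also have "\<dots> \<le> (\<Sum>i\<in>UNIV. \<Sum>j\<in>UNIV. b i j)" by (intro sum_mono entry that)
    finally show ?thesis .
  qed
  then show ?thesis unfolding bounded_iff by blast
qed

lemma tendsto_inv_lyapunov:
  assumes "lyapunov_stable A" "(W \<longlongrightarrow> V) F"
  shows "((\<lambda>k. inv (lyapunov A) (W k)) \<longlongrightarrow> inv (lyapunov A) V) F"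
proof -
  have "linear (inv (lyapunov A))"
    by (intro inj_linear_imp_inv_linear linear_lyapunov lyapunov_stable_inj assms)
  then show ?thesis using assms(2) bounded_linear.tendsto linear_conv_bounded_linear by blast
qed

lemma tendsto_C_hat:
  assumes "lyapunov_stable A" "(M \<longlongrightarrow> M0) F" "(L \<longlongrightarrow> L0) F"
  shows "((\<lambda>k. C_hat A B (M k) (L k)) \<longlongrightarrow> C_hat A B M0 L0) F"
  unfolding C_hat_def
  by (intro tendsto_intros tendsto_matrix_matrix_mult tendsto_transpose tendsto_inv_lyapunov assms)

lemma matrix_inverse_of_pos:
  fixes M :: "real^'n^'n"
  assumes "transpose M = M" "\<And>x. x \<noteq> 0 \<Longrightarrow> 0 < x \<bullet> (M *v x)"
  obtains N where "M ** N = mat 1" "transpose N = N"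
proof -
  have "\<forall>x. M *v x = 0 \<longrightarrow> x = 0" using assms(2) by (metis inner_zero_right less_irrefl)
  then obtain N where N: "N ** M = mat 1" using matrix_left_invertible_ker[of M] by blast
  then have MN: "M ** N = mat 1" by (simp add: matrix_left_right_inverse)
  have "transpose N ** M = mat 1" using arg_cong[OF MN, of transpose] by (simp add: matrix_transpose_mul assms(1))
  then have "transpose N = N" by (metis MN matrix_mul_assoc matrix_mul_lid matrix_mul_rid)
  with MN show thesis by (rule that)
qed

text \<open>An exact energy balance: by completing the square, the slack in the dissipation
  inequality for the output \<open>C_hat A B M L\<close> is the square of
  \<open>transpose L *v x + M *v u\<close>. It serves both convexity and passivity.\<close>

lemma dissipation_C_hat:
  assumes "lyapunov_stable A" "transpose M = M"
  defines "Q \<equiv> \<lambda>L. inv (lyapunov A) (- (L ** transpose L))"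
  shows "transpose (Q L) = Q L" and "0 \<le> x \<bullet> (Q L *v x)"
    and "2 * (x \<bullet> (Q L *v (A *v x + B *v u)))
      = 2 * (u \<bullet> (C_hat A B M L *v x)) + (norm (M *v u))\<^sup>2 - (norm (transpose L *v x + M *v u))\<^sup>2"
proof -
  show sym: "transpose (Q L) = Q L" unfolding Q_def
    by (intro transpose_inv_lyapunov assms) (simp add: transpose_uminus matrix_transpose_mul)
  have "x \<bullet> (L *v (transpose L *v x)) = (norm (transpose L *v x))\<^sup>2" for x
    unfolding power2_norm_eq_inner transpose_dot ..
  then have QA: "2 * (x \<bullet> (Q L *v (A *v x))) = - (norm (transpose L *v x))\<^sup>2" for x
    using lyapunov_diag[OF sym, of x A] inv_lyapunov(1)[OF assms(1), of "- (L ** transpose L)"]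
    by (simp add: Q_def uminus_matrix_vector_mult matrix_vector_mul_assoc[symmetric] del: transpose_matrix_vector)
  show "0 \<le> x \<bullet> (Q L *v x)"
  proof (rule lyapunov_stable_nonneg[OF assms(1) sym])
    show "x \<bullet> (Q L *v (A *v x)) \<le> 0" for x
      using QA[of x] zero_le_power2[of "norm (transpose L *v x)"] by linarith
  qed
  have "u \<bullet> (C_hat A B M L *v x) = u \<bullet> (transpose B *v (Q L *v x)) + u \<bullet> (M *v (transpose L *v x))"
    by (simp add: C_hat_def Q_def matrix_vector_mult_add_rdistrib matrix_vector_mul_assoc[symmetric] inner_simps
        del: transpose_matrix_vector)
  also have "u \<bullet> (transpose B *v (Q L *v x)) = x \<bullet> (Q L *v (B *v u))"
    unfolding inner_commute[of u] transpose_dot sym_matrix_dot[OF sym] ..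
  also have "u \<bullet> (M *v (transpose L *v x)) = (M *v u) \<bullet> (transpose L *v x)"
    by (rule sym_matrix_dot[OF assms(2), symmetric])
  finally have C: "u \<bullet> (C_hat A B M L *v x) = x \<bullet> (Q L *v (B *v u)) + (M *v u) \<bullet> (transpose L *v x)" .
  have "(norm (transpose L *v x + M *v u))\<^sup>2
      = (norm (transpose L *v x))\<^sup>2 + 2 * ((M *v u) \<bullet> (transpose L *v x)) + (norm (M *v u))\<^sup>2"
    by (simp add: power2_norm_eq_inner inner_add_left inner_add_right inner_commute del: transpose_matrix_vector)
  then show "2 * (x \<bullet> (Q L *v (A *v x + B *v u)))
      = 2 * (u \<bullet> (C_hat A B M L *v x)) + (norm (M *v u))\<^sup>2 - (norm (transpose L *v x + M *v u))\<^sup>2"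
    unfolding C matrix_vector_right_distrib inner_add_right distrib_left using QA[of x] by linarith
qed

text \<open>For \<open>M\<close> possibly singular, the factorisation is obtained as the limit of those for
  \<open>M + e I\<close> with \<open>e \<rightarrow> 0\<close>.\<close>

lemma spectral_factor:
  fixes A Q :: "real^'n^'n" and B :: "real^'m^'n"
  assumes stable: "lyapunov_stable A" and M: "sym_psd M" and Q: "transpose Q = Q"
    and diss: "\<And>x u. 2 * (x \<bullet> (Q *v (A *v x + B *v u))) \<le> 2 * (u \<bullet> (C *v x)) + (norm (M *v u))\<^sup>2"
  shows "\<exists>L. C_hat A B M L = C"
proof -
  define e where "e = (\<lambda>k. 1 / real (Suc k))"
  have e: "e k > 0" for k by (simp add: e_def)
  define Me where "Me = (\<lambda>k. M + e k *\<^sub>R mat 1)"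
  have Me_apply: "Me k *v u = M *v u + e k *\<^sub>R u" for k u
    by (simp add: Me_def matrix_vector_mult_add_rdistrib)
  have Me_sym: "transpose (Me k) = Me k" for k
    using M by (simp add: Me_def sym_psd_def transpose_add transpose_scalar)
  have Mnn: "0 \<le> u \<bullet> (M *v u)" for u using M by (simp add: sym_psd_def)
  \<comment> \<open>Enlarging \<open>M\<close> only adds supply, so one and the same
    \<open>Q\<close> remains feasible for every \<open>k\<close>.\<close>
  have norm_le: "(norm (M *v u))\<^sup>2 \<le> (norm (Me k *v u))\<^sup>2" for k u
  proof -
    have "(norm (Me k *v u))\<^sup>2 = (norm (M *v u))\<^sup>2 + 2 * e k * (u \<bullet> (M *v u)) + (norm (e k *\<^sub>R u))\<^sup>2"
      unfolding Me_apply power2_norm_eq_inner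
      by (simp add: inner_add_left inner_add_right inner_commute)
    moreover have "0 \<le> 2 * e k * (u \<bullet> (M *v u))" using Mnn[of u] e[of k] by simp
    ultimately show ?thesis using zero_le_power2[of "norm (e k *\<^sub>R u)"] by linarith
  qed
  \<comment> \<open>The second conjunct records bounds on \<open>X\<close> that do not depend on
    \<open>k\<close>; compactness of the factors rests on them.\<close>
  let ?P = "\<lambda>k L. C_hat A B (Me k) L = C
      \<and> (\<exists>X. transpose X = X \<and> (\<forall>x. 0 \<le> x \<bullet> (X *v x)) \<and> (\<forall>x. x \<bullet> (X *v x) \<le> x \<bullet> (Q *v x)) \<and> L ** transpose L = - lyapunov A X)"
  have "\<exists>L. ?P k L" for k
  proof -
    have "0 < u \<bullet> (Me k *v u)" if "u \<noteq> 0" for u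
      using Mnn[of u] e[of k] that by (simp add: Me_apply inner_simps add_nonneg_pos)
    then obtain N where N: "Me k ** N = mat 1" "transpose N = N"
      using matrix_inverse_of_pos[OF Me_sym] by blast
    have MN: "Me k *v (N *v u) = u" for u using N(1) by (simp add: matrix_vector_mul_assoc)
    interpret kyp A B C N Q
    proof
      fix x
      define l where "l = N *v (C *v x - transpose B *v (Q *v x))"
      \<comment> \<open>The worst input for the state \<open>x\<close>: it maximises the left side
        minus the right side of the perturbed dissipation inequality.\<close>
      define u where "u = - (N *v l)"
      have "Me k *v u = - l" using MN[of l] linear_neg[OF matrix_vector_mul_linear, of "Me k" "N *v l"]
        by (simp add: u_def)
      then have "2 * (x \<bullet> (Q *v (A *v x + B *v u))) \<le> 2 * (u \<bullet> (C *v x)) + (norm l)\<^sup>2"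
        using order_trans[OF diss[of x u] add_left_mono[OF norm_le[of u k]]] by simp
      moreover have "x \<bullet> (Q *v (B *v u)) = u \<bullet> (transpose B *v (Q *v x))"
        unfolding inner_commute[of u] transpose_dot sym_matrix_dot[OF Q] ..
      moreover have "u \<bullet> (C *v x) - u \<bullet> (transpose B *v (Q *v x)) = - (norm l)\<^sup>2"
      proof -
        have "u \<bullet> (C *v x) - u \<bullet> (transpose B *v (Q *v x)) = u \<bullet> (C *v x - transpose B *v (Q *v x))"
          by (rule inner_diff_right[symmetric])
        also have "\<dots> = - (l \<bullet> l)" unfolding u_def inner_minus_left sym_matrix_dot[OF N(2)] l_def ..
        finally show ?thesis by (simp add: power2_norm_eq_inner)
      qed
      ultimately show "2 * (x \<bullet> (Q *v (A *v x))) + (norm (N *v (C *v x - transpose B *v (Q *v x))))\<^sup>2 \<le> 0"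
        unfolding l_def[symmetric] matrix_vector_right_distrib inner_add_right distrib_left by linarith
    qed (use stable N Q in auto)
    obtain X where X: "transpose X = X" "\<And>x. 0 \<le> x \<bullet> (X *v x)" "\<And>x. x \<bullet> (X *v x) \<le> x \<bullet> (Q *v x)"
      "lyapunov A X = - (transpose (gain X) ** gain X)" using riccati_solution by blast
    let ?L = "transpose (gain X)"
    have "inv (lyapunov A) (- (?L ** transpose ?L)) = X"
      using inv_lyapunov(2)[OF stable, of X] by (simp add: X(4))
    moreover have "Me k ** transpose ?L = C - transpose B ** X"
      by (simp add: gain_def matrix_mul_assoc N(1))
    ultimately have "C_hat A B (Me k) ?L = C" by (simp add: C_hat_def)
    moreover have "?L ** transpose ?L = - lyapunov A X" by (simp add: X(4))
    ultimately show ?thesis using X(1,2,3) by (intro exI[of _ ?L]) auto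
  qed
  then obtain L where L: "\<And>k. C_hat A B (Me k) (L k) = C"
      "\<And>k. \<exists>X. transpose X = X \<and> (\<forall>x. 0 \<le> x \<bullet> (X *v x)) \<and> (\<forall>x. x \<bullet> (X *v x) \<le> x \<bullet> (Q *v x)) \<and> L k ** transpose (L k) = - lyapunov A X"
    by metis
  obtain b where b: "norm (lyapunov A X) \<le> b"
    if "transpose X = X" "\<forall>x. 0 \<le> x \<bullet> (X *v x)" "\<forall>x. x \<bullet> (X *v x) \<le> x \<bullet> (Q *v x)" for X
    using bounded_linear_image[OF bounded_sym_matrix_interval[of Q] linear_conv_bounded_linear[THEN iffD1, OF linear_lyapunov[of A]]]
    unfolding bounded_iff by blast
  have "norm (L k) \<le> sqrt (real CARD('n) * b)" for k
  proof -
    have "norm (L k ** transpose (L k)) \<le> b" using L(2)[of k] b by auto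
    then have "(norm (L k))\<^sup>2 \<le> real CARD('n) * b"
      using norm_square_le_norm_gram[of "L k"] by (meson mult_left_mono of_nat_0_le_iff order_trans)
    then show ?thesis by (simp add: real_le_rsqrt)
  qed
  then have "bounded (range L)" unfolding bounded_iff by blast
  then obtain L0 r where r: "strict_mono r" "(L \<circ> r) \<longlonglongrightarrow> L0" using bounded_imp_convergent_subsequence by blast
  have "Me \<longlonglongrightarrow> M + 0 *\<^sub>R mat 1"
    unfolding Me_def e_def by (intro tendsto_intros LIMSEQ_Suc[OF lim_1_over_n])
  then have "(Me \<circ> r) \<longlonglongrightarrow> M" using LIMSEQ_subseq_LIMSEQ[OF _ r(1)] by fastforce
  then have "(\<lambda>k. C_hat A B ((Me \<circ> r) k) ((L \<circ> r) k)) \<longlonglongrightarrow> C_hat A B M L0"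
    by (rule tendsto_C_hat[OF stable _ r(2)])
  then have "(\<lambda>k :: nat. C) \<longlonglongrightarrow> C_hat A B M L0" by (simp add: L(1))
  then have "C_hat A B M L0 = C" by (simp add: LIMSEQ_const_iff)
  then show ?thesis by blast
qed

text \<open>Midpoints suffice for uniqueness. The storage matrix for the averaged output is the
  average of the two storage matrices.\<close>

lemma C_hat_midpoint:
  assumes stable: "lyapunov_stable A" and M: "sym_psd M"
  shows "\<exists>L. C_hat A B M L = (1 / 2) *\<^sub>R (C_hat A B M L1 + C_hat A B M L2)"
proof (rule spectral_factor[OF stable M])
  have Msym: "transpose M = M" using M by (simp add: sym_psd_def)
  let ?Q = "\<lambda>L. inv (lyapunov A) (- (L ** transpose L))"
  note d = dissipation_C_hat[OF stable Msym]
  show "transpose ((1 / 2) *\<^sub>R (?Q L1 + ?Q L2)) = (1 / 2) *\<^sub>R (?Q L1 + ?Q L2)"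
    by (simp add: transpose_scalar transpose_add d(1))
  fix x u
  have "2 * (x \<bullet> (?Q L *v (A *v x + B *v u))) \<le> 2 * (u \<bullet> (C_hat A B M L *v x)) + (norm (M *v u))\<^sup>2" for L
    using d(3)[of x L B u] zero_le_power2[of "norm (transpose L *v x + M *v u)"] by linarith
  moreover have "2 * (1 / 2 * (a + b)) \<le> 2 * (1 / 2 * (c + d)) + f" if "2 * a \<le> 2 * c + f" "2 * b \<le> 2 * d + f"
    for a b c d f :: real using that by (simp add: field_simps)
  ultimately show "2 * (x \<bullet> (((1 / 2) *\<^sub>R (?Q L1 + ?Q L2)) *v (A *v x + B *v u)))
      \<le> 2 * (u \<bullet> (((1 / 2) *\<^sub>R (C_hat A B M L1 + C_hat A B M L2)) *v x)) + (norm (M *v u))\<^sup>2"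
    unfolding scaleR_matrix_vector_assoc[symmetric] matrix_vector_mult_add_rdistrib inner_scaleR_right inner_add_right
    by blast
qed

section \<open>Controllability and coercivity\<close>

lemma state_trajectory_continuous:
  assumes "state_trajectory A B u x" "a \<le> b"
  shows "continuous_on {a..b} x"
proof -
  let ?f = "\<lambda>t. A *v x t + B *v u t"
  have I: "(?f has_integral (x t - x s)) {s..t}" if "s \<le> t" for s t
    using assms(1) that unfolding state_trajectory_def by blast
  have "continuous_on {a..b} (\<lambda>t. x a + integral {a..t} ?f)"
    using has_integral_integrable[OF I[OF assms(2)]] by (intro continuous_intros indefinite_integral_continuous_1)
  moreover have "x a + integral {a..t} ?f = x t" if "t \<in> {a..b}" for t
    using integral_unique[OF I[of a t]] that by simp
  ultimately show ?thesis using continuous_on_eq by blast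
qed

text \<open>Steer from 0 to \<open>y\<close> and set \<open>z k = (A\<^sup>T)\<^sup>k y\<close>.
  Each \<open>z k\<close> is orthogonal to \<open>S\<close>, hence to every \<open>B u\<close>, so
  the input drops out and \<open>z k \<bullet> x\<close> is the integral of
  \<open>z (Suc k) \<bullet> x\<close>. Repeated integration bounds \<open>y \<bullet> y\<close> by
  a multiple of \<open>(a * T) ^ j / fact j\<close> for every \<open>j\<close>.\<close>

lemma controllable_imp_orthogonal_complement_zero:
  fixes A :: "real^'n^'n" and B :: "real^'m^'n" and y :: "real^'n"
  assumes ctrl: "controllable A B" and inv: "\<And>s. s \<in> S \<Longrightarrow> A *v s \<in> S" and B: "\<And>u. B *v u \<in> S"
    and orth: "\<And>s. s \<in> S \<Longrightarrow> y \<bullet> s = 0"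
  shows "y = 0"
proof -
  obtain T u x where "T > 0" and x: "state_trajectory A B u x" "x 0 = 0" "x T = y"
    using ctrl unfolding controllable_def by metis
  define f where "f = (\<lambda>t. A *v x t + B *v u t)"
  have I: "(f has_integral (x b - x a)) {a..b}" if "a \<le> b" for a b
    using x(1) that unfolding state_trajectory_def f_def by blast
  have cont: "continuous_on {0..T} x"
    using state_trajectory_continuous[OF x(1)] \<open>T > 0\<close> by simp
  then obtain m where m: "\<And>t. t \<in> {0..T} \<Longrightarrow> norm (x t) \<le> m"
    using compact_imp_bounded[OF compact_continuous_image[OF cont compact_Icc]] unfolding bounded_iff by blast
  have "0 \<le> m" using m[of 0] \<open>T > 0\<close> x(2) by simp
  define z where "z = (\<lambda>k. ((\<lambda>v. transpose A *v v) ^^ k) y)"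
  have z: "z 0 = y" "z (Suc k) = transpose A *v z k" for k by (simp_all add: z_def)
  have zS: "s \<in> S \<Longrightarrow> z k \<bullet> s = 0" for k s
  proof (induction k arbitrary: s)
    case (Suc k)
    then show ?case unfolding z(2) transpose_dot using inv by blast
  qed (simp add: z orth)
  define a where "a = onorm ((*v) (transpose A))"
  have "0 \<le> a" unfolding a_def by (rule onorm_pos_le[OF matrix_vector_mul_bounded_linear])
  have zn: "norm (z k) \<le> a ^ k * norm y" for k
  proof (induction k)
    case (Suc k)
    have "norm (z (Suc k)) \<le> a * norm (z k)"
      unfolding z(2) a_def by (rule onorm[OF matrix_vector_mul_bounded_linear])
    also have "\<dots> \<le> a * (a ^ k * norm y)" by (rule mult_left_mono[OF Suc \<open>0 \<le> a\<close>])
    finally show ?case by simp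
  qed (simp add: z)
  have deriv: "((\<lambda>s. z (Suc k) \<bullet> x s) has_integral z k \<bullet> x t) {0..t}" if "0 \<le> t" for k t
  proof -
    have "((\<lambda>s. z k \<bullet> f s) has_integral z k \<bullet> (x t - x 0)) {0..t}"
      using has_integral_linear[OF I[OF that] bounded_linear_inner_right[of "z k"]] by (simp add: o_def)
    moreover have "z k \<bullet> f s = z (Suc k) \<bullet> x s" for s
      unfolding f_def inner_add_right zS[OF B] z(2) transpose_dot by simp
    ultimately show ?thesis by (simp add: x(2))
  qed
  have bound: "\<bar>z k \<bullet> x t\<bar> \<le> a ^ (k + j) * norm y * m * t ^ j / fact j" if "t \<in> {0..T}" for j k t
    using that
  proof (induction j arbitrary: k t)
    case 0
    have "\<bar>z k \<bullet> x t\<bar> \<le> norm (z k) * norm (x t)" by (rule Cauchy_Schwarz_ineq2)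
    also have "\<dots> \<le> (a ^ k * norm y) * m"
      using \<open>0 \<le> a\<close> 0 by (intro mult_mono zn m) auto
    finally show ?case by simp
  next
    case (Suc j)
    define c where "c = a ^ (Suc k + j) * norm y * m / fact j"
    have pow: "((\<lambda>s. c * s ^ j) has_integral c * (t ^ Suc j / Suc j)) {0..t}"
    proof -
      have "((\<lambda>s. s ^ j) has_integral (t ^ Suc j / Suc j - 0 ^ Suc j / Suc j)) {0..t}"
        using Suc.prems by (intro fundamental_theorem_of_calculus)
          (auto intro!: derivative_eq_intros simp: has_real_derivative_iff_has_vector_derivative[symmetric] simp del: power_Suc of_nat_Suc)
      from has_integral_mult_right[OF this, of c] show ?thesis by simp
    qed
    have le: "\<bar>z (Suc k) \<bullet> x s\<bar> \<le> c * s ^ j" if "s \<in> {0..t}" for s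
      using Suc.IH[of s "Suc k"] that Suc.prems by (simp add: c_def)
    have int: "((\<lambda>s. z (Suc k) \<bullet> x s) has_integral z k \<bullet> x t) {0..t}" using deriv Suc.prems by simp
    have "norm (integral {0..t} (\<lambda>s. z (Suc k) \<bullet> x s)) \<le> integral {0..t} (\<lambda>s. c * s ^ j)"
      using has_integral_integrable[OF int] has_integral_integrable[OF pow] le
      by (intro integral_norm_bound_integral) simp_all
    then have "norm (z k \<bullet> x t) \<le> c * (t ^ Suc j / Suc j)"
      unfolding integral_unique[OF int] integral_unique[OF pow] .
    also have "\<dots> = a ^ (k + Suc j) * norm y * m * t ^ Suc j / fact (Suc j)"
      by (simp add: c_def)
    finally show ?case by simp
  qed
  have "(\<lambda>j. norm y * m * ((a * T) ^ j / fact j)) \<longlonglongrightarrow> norm y * m * 0"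
  proof (intro tendsto_mult tendsto_const)
    have "summable (\<lambda>j. inverse (fact j) * (a * T) ^ j)" by (rule summable_exp)
    then show "(\<lambda>j. (a * T) ^ j / fact j) \<longlonglongrightarrow> 0"
      using summable_LIMSEQ_zero by (simp add: divide_inverse mult.commute)
  qed
  moreover have "\<bar>y \<bullet> y\<bar> \<le> norm y * m * ((a * T) ^ j / fact j)" for j
    using bound[of T 0 j] \<open>T > 0\<close> x(3) by (simp add: z power_mult_distrib mult_ac)
  ultimately have "\<bar>y \<bullet> y\<bar> \<le> norm y * m * 0" by (intro LIMSEQ_le_const) auto
  then show ?thesis by simp (metis inner_gt_zero_iff not_le)
qed

text \<open>The kernel of \<open>Z\<close> is invariant under \<open>A\<close>: for \<open>s\<close>
  in it, testing the equation with \<open>s\<close> gives \<open>transpose L *v s = 0\<close>, and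
  then the equation itself gives \<open>Z (A s) = 0\<close>. The kernel contains the range of
  \<open>B\<close>, while every \<open>Z x\<close> is orthogonal to it.\<close>

lemma lyapunov_kernel_contains_range_imp_zero:
  fixes A :: "real^'n^'n" and B L :: "real^'m^'n"
  assumes ctrl: "controllable A B" and sym: "transpose Z = Z"
    and lyap: "lyapunov A Z = - (L ** transpose L)" and ZB: "Z ** B = 0"
  shows "Z = 0"
proof -
  have "Z *v x = 0" for x
  proof (rule controllable_imp_orthogonal_complement_zero[OF ctrl])
    fix s assume "s \<in> {s. Z *v s = 0}"
    then have s: "Z *v s = 0" by simp
    have eq: "transpose A *v (Z *v v) + Z *v (A *v v) = - (L *v (transpose L *v v))" for v
    proof -
      have "lyapunov A Z *v v = - (L ** transpose L) *v v" by (simp only: lyap)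
      then show ?thesis
        by (simp only: lyapunov_def matrix_vector_mult_add_rdistrib matrix_vector_mul_assoc uminus_matrix_vector_mult)
    qed
    have "s \<bullet> (L *v (transpose L *v s)) = - (s \<bullet> (Z *v (A *v s)))"
      using arg_cong[OF eq[of s], of "(\<bullet>) s"] by (simp add: s)
    also have "\<dots> = 0" unfolding sym_matrix_dot[OF sym, symmetric] s by simp
    finally have "transpose L *v s = 0"
      unfolding inner_commute[of s] using transpose_dot[of "transpose L" "transpose L *v s" s]
      by (metis inner_eq_zero_iff transpose_transpose)
    then show "A *v s \<in> {s. Z *v s = 0}" using eq[of s] by (simp add: s)
  next
    show "B *v u \<in> {s. Z *v s = 0}" for u by (simp add: matrix_vector_mul_assoc ZB)
    show "(Z *v x) \<bullet> s = 0" if "s \<in> {s. Z *v s = 0}" for s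
      using that by (simp add: sym_matrix_dot[OF sym])
  qed
  then show ?thesis by (simp add: matrix_eq)
qed

lemma C_hat_scaleR:
  assumes "lyapunov_stable A"
  shows "C_hat A B M (t *\<^sub>R L) = t *\<^sub>R (C_hat A B M L) + (t\<^sup>2 - t) *\<^sub>R (transpose B ** inv (lyapunov A) (- (L ** transpose L)))"
proof -
  have "linear (inv (lyapunov A))"
    by (intro inj_linear_imp_inv_linear linear_lyapunov lyapunov_stable_inj assms)
  then have "inv (lyapunov A) (t\<^sup>2 *\<^sub>R W) = t\<^sup>2 *\<^sub>R inv (lyapunov A) W" for W
    by (rule linear_scale)
  from this[of "- (L ** transpose L)"]
  have "inv (lyapunov A) (- ((t *\<^sub>R L) ** transpose (t *\<^sub>R L))) = t\<^sup>2 *\<^sub>R inv (lyapunov A) (- (L ** transpose L))"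
    by (simp add: transpose_scalar bounded_bilinear.scaleR_left[OF bounded_bilinear_matrix_matrix_mult]
        bounded_bilinear.scaleR_right[OF bounded_bilinear_matrix_matrix_mult] power2_eq_square)
  then show ?thesis
    by (simp add: C_hat_def transpose_scalar bounded_bilinear.scaleR_left[OF bounded_bilinear_matrix_matrix_mult]
        bounded_bilinear.scaleR_right[OF bounded_bilinear_matrix_matrix_mult] algebra_simps)
qed

text \<open>Rescaling an unbounded sequence \<open>L k\<close> with bounded images to unit norm gives a limit \<open>L0\<close> of
  norm 1 with \<open>B\<^sup>T Z = 0\<close>, \<open>Z\<close> being the Lyapunov solution for \<open>L0\<close>; by controllability \<open>Z = 0\<close>.\<close>

lemma C_hat_coercive:
  fixes A :: "real^'n^'n" and B :: "real^'m^'n"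
  assumes stable: "lyapunov_stable A" and ctrl: "controllable A B"
  shows "bounded {L. norm (C_hat A B M L) \<le> r}"
proof (rule ccontr)
  assume "\<not> ?thesis"
  then have "\<exists>L. norm (C_hat A B M L) \<le> r \<and> real (Suc k) < norm L" for k
    unfolding bounded_iff by (metis mem_Collect_eq not_le)
  then obtain L where L: "\<And>k. norm (C_hat A B M (L k)) \<le> r" "\<And>k. real (Suc k) < norm (L k)" by metis
  define e where "e = (\<lambda>k. 1 / norm (L k))"
  have pos: "0 < norm (L k)" for k using L(2)[of k] by (meson le_less_trans of_nat_0_le_iff)
  have elim: "e \<longlonglongrightarrow> 0"
  proof (rule tendsto_sandwich[OF _ _ tendsto_const LIMSEQ_Suc[OF lim_1_over_n]])
    show "\<forall>\<^sub>F k in sequentially. 0 \<le> e k" by (simp add: e_def)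
    show "\<forall>\<^sub>F k in sequentially. e k \<le> 1 / real (Suc k)"
      unfolding e_def by (intro always_eventually allI divide_left_mono less_imp_le[OF L(2)]) (use pos in auto)
  qed
  have "e k *\<^sub>R L k \<in> sphere 0 1" for k using pos[of k] by (simp add: e_def)
  then obtain L0 \<rho> where L0: "L0 \<in> sphere 0 1" and \<rho>: "strict_mono \<rho>" "((\<lambda>k. e k *\<^sub>R L k) \<circ> \<rho>) \<longlonglongrightarrow> L0"
    using compact_sphere[unfolded compact_def, rule_format, of "\<lambda>k. e k *\<^sub>R L k" 0 1] by blast
  define Z where "Z = inv (lyapunov A) (- (L0 ** transpose L0))"
  have e\<rho>: "(\<lambda>k. e (\<rho> k)) \<longlonglongrightarrow> 0" using LIMSEQ_subseq_LIMSEQ[OF elim \<rho>(1)] by (simp add: o_def)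
  have lim: "(\<lambda>k. C_hat A B (e (\<rho> k) *\<^sub>R M) (e (\<rho> k) *\<^sub>R L (\<rho> k))) \<longlonglongrightarrow> C_hat A B (0 *\<^sub>R M) L0"
    using \<rho>(2) by (intro tendsto_C_hat stable tendsto_intros e\<rho>) (simp add: o_def)
  \<comment> \<open>Scaling \<open>M\<close> together with \<open>L\<close> makes
    \<open>C_hat\<close> homogeneous of degree 2. In the limit the scaled \<open>M\<close> vanishes
    and only the Lyapunov term remains.\<close>
  have scale: "C_hat A B (t *\<^sub>R M) (t *\<^sub>R X) = t\<^sup>2 *\<^sub>R C_hat A B M X" for t X
    unfolding C_hat_scaleR[OF stable]
    by (simp add: C_hat_def transpose_scalar bounded_bilinear.scaleR_left[OF bounded_bilinear_matrix_matrix_mult]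
        algebra_simps power2_eq_square)
  have "(\<lambda>k. (e (\<rho> k))\<^sup>2 *\<^sub>R C_hat A B M (L (\<rho> k))) \<longlonglongrightarrow> 0"
  proof (rule Lim_null_comparison)
    show "\<forall>\<^sub>F k in sequentially. norm ((e (\<rho> k))\<^sup>2 *\<^sub>R C_hat A B M (L (\<rho> k))) \<le> (e (\<rho> k))\<^sup>2 * r"
      by (intro always_eventually allI) (simp add: mult_left_mono L(1))
    show "(\<lambda>k. (e (\<rho> k))\<^sup>2 * r) \<longlonglongrightarrow> 0" using tendsto_mult[OF tendsto_power[OF e\<rho>, of 2] tendsto_const[of r]] by simp
  qed
  with lim have "C_hat A B (0 *\<^sub>R M) L0 = 0" unfolding scale by (rule LIMSEQ_unique)
  then have BZ: "transpose B ** Z = 0" by (simp add: C_hat_def Z_def)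
  have sym: "transpose Z = Z" unfolding Z_def
    by (intro transpose_inv_lyapunov stable) (simp add: transpose_uminus matrix_transpose_mul)
  have "transpose (transpose B ** Z) = transpose (0 :: real^'n^'m)" by (simp only: BZ)
  then have "Z ** B = 0" by (simp add: matrix_transpose_mul sym) (simp add: transpose_def vec_eq_iff)
  moreover have lyap: "lyapunov A Z = - (L0 ** transpose L0)" unfolding Z_def by (rule inv_lyapunov(1)[OF stable])
  ultimately have "Z = 0" using lyapunov_kernel_contains_range_imp_zero[OF ctrl sym] by blast
  \<comment> \<open>The Gram matrix of \<open>L0\<close> is determined by \<open>Z\<close>, so its
    vanishing contradicts the unit norm of \<open>L0\<close>.\<close>
  then have "L0 ** transpose L0 = 0" using lyap linear_0[OF linear_lyapunov[of A]] by simp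
  then have "(norm L0)\<^sup>2 \<le> 0" using norm_square_le_norm_gram[of L0] by simp
  then show False using L0 by simp
qed

section \<open>The H2 norm as a quadratic form\<close>

lemma integrable_inverse_one_plus_square: "integrable lborel (\<lambda>x :: real. inverse (1 + x\<^sup>2))"
proof -
  have "set_integrable lborel (einterval (- \<infinity>) \<infinity>) (\<lambda>x :: real. inverse (1 + x\<^sup>2))"
  proof (rule interval_integral_FTC_nonneg(1))
    show "(arctan has_real_derivative inverse (1 + x\<^sup>2)) (at x)" for x by (rule DERIV_arctan)
    show "isCont (\<lambda>x :: real. inverse (1 + x\<^sup>2)) x" for x
      by (intro continuous_intros) (simp add: add_nonneg_eq_0_iff)
    show "((arctan \<circ> real_of_ereal) \<longlongrightarrow> - (pi / 2)) (at_right (- \<infinity>))"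
      "((arctan \<circ> real_of_ereal) \<longlongrightarrow> pi / 2) (at_left \<infinity>)"
      unfolding ereal_tendsto_simps by (rule tendsto_arctan_at_bot tendsto_arctan_at_top)+
  qed (auto intro!: AE_I2)
  then show ?thesis by (simp add: set_integrable_def einterval_def)
qed

section \<open>The resolvent on the imaginary axis\<close>

lemma matrix_inv_mult:
  fixes M :: "'a::field^'n^'n"
  assumes "\<And>v. M *v v = 0 \<Longrightarrow> v = 0"
  shows "M ** matrix_inv M = mat 1" "matrix_inv M ** M = mat 1"
proof -
  have "\<exists>N. N ** M = mat 1" unfolding matrix_left_invertible_ker using assms by simp
  then obtain N where "N ** M = mat 1" ..
  then have "M ** N = mat 1 \<and> N ** M = mat 1" using matrix_left_right_inverse[of N M] by blast
  then have "M ** matrix_inv M = mat 1 \<and> matrix_inv M ** M = mat 1"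
    unfolding matrix_inv_def by (rule someI)
  then show "M ** matrix_inv M = mat 1" "matrix_inv M ** M = mat 1" by simp_all
qed

lemma norm_scalar_mult: "norm (z *s v) = norm z * norm v" for v :: "'a::real_normed_field^'n"
  by (simp add: norm_vec_def norm_mult L2_set_right_distrib)

text \<open>Compactness gives the bound for bounded \<open>\<omega>\<close>, the triangle inequality for large \<open>\<omega>\<close>.\<close>

lemma hurwitz_resolvent_lower_bound:
  fixes A :: "real^'n^'n"
  assumes "hurwitz A"
  obtains c where "c > 0"
    "\<And>\<omega> v. c * (1 + \<bar>\<omega>\<bar>) * norm v \<le> norm ((mat (\<i> * complex_of_real \<omega>) - cmatrix A) *v v)"
proof -
  define S where "S = (\<lambda>\<omega>. mat (\<i> * complex_of_real \<omega>) - cmatrix A)"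
  have S: "S \<omega> *v v = (\<i> * complex_of_real \<omega>) *s v - cmatrix A *v v" for \<omega> v
    by (simp add: S_def matrix_vector_mult_diff_rdistrib mat_mult_vector)
  have inj: "v = 0" if "S \<omega> *v v = 0" for \<omega> v
  proof (rule ccontr)
    assume "v \<noteq> 0"
    then have "eigenvalue (cmatrix A) (\<i> * complex_of_real \<omega>)" using that by (auto simp: eigenvalue_def S)
    then show False using assms unfolding hurwitz_def by fastforce
  qed
  define a where "a = onorm ((*v) (cmatrix A))"
  have "0 \<le> a" unfolding a_def by (rule onorm_pos_le[OF matrix_vector_mul_bounded_linear])
  \<comment> \<open>Beyond this radius \<open>\<bar>\<omega>\<bar> - a\<close> is at least
    \<open>(1 + \<bar>\<omega>\<bar>) / 2\<close>, which is the origin of the constant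
    \<open>1 / 2\<close> in \<open>c\<close>.\<close>
  define R where "R = 2 * a + 1"
  let ?T = "{-R..R} \<times> sphere (0 :: complex^'n) 1"
  have "axis undefined 1 \<in> sphere (0 :: complex^'n) 1" by (simp add: norm_eq_sqrt_inner inner_axis_axis)
  moreover have "0 \<in> {-R..R}" using \<open>0 \<le> a\<close> by (simp add: R_def)
  ultimately have "?T \<noteq> {}" by blast
  moreover have "compact ?T" by (intro compact_Times compact_Icc compact_sphere)
  moreover have "continuous_on ?T (\<lambda>p. norm (S (fst p) *v snd p))"
  proof -
    have "continuous_on ?T (\<lambda>p. cmatrix A *v snd p)"
      by (intro bounded_linear.continuous_on[OF matrix_vector_mul_bounded_linear] continuous_intros)
    moreover have "continuous_on ?T (\<lambda>p. (\<i> * complex_of_real (fst p)) *s snd p)"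
      unfolding vector_scalar_mult_def by (intro continuous_on_vec_lambda continuous_intros)
    ultimately show ?thesis unfolding S by (intro continuous_intros)
  qed
  ultimately obtain p where p: "p \<in> ?T" "\<And>q. q \<in> ?T \<Longrightarrow> norm (S (fst p) *v snd p) \<le> norm (S (fst q) *v snd q)"
    using continuous_attains_inf by meson
  define c0 where "c0 = norm (S (fst p) *v snd p)"
  have "c0 > 0" using p(1) inj[of "fst p" "snd p"] by (auto simp: c0_def)
  define c where "c = min (1 / 2) (c0 / (1 + R))"
  have "0 < 1 + R" using \<open>0 \<le> a\<close> by (simp add: R_def)
  show thesis
  proof
    show "c > 0" using \<open>c0 > 0\<close> \<open>0 < 1 + R\<close> by (simp add: c_def)
    fix \<omega> v
    have "c * (1 + \<bar>\<omega>\<bar>) * norm v \<le> norm (S \<omega> *v v)"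
    proof (cases "\<bar>\<omega>\<bar> \<le> R")
      case True
      have "c0 * norm v \<le> norm (S \<omega> *v v)"
      proof (cases "v = 0")
        case False
        let ?v = "complex_of_real (1 / norm v) *s v"
        have "(\<omega>, ?v) \<in> ?T" using True False by (auto simp: norm_scalar_mult norm_divide)
        then have "c0 \<le> norm (S \<omega> *v ?v)" using p(2) unfolding c0_def by fastforce
        also have "\<dots> = norm (S \<omega> *v v) / norm v"
          using False by (simp add: vector_scalar_commute norm_scalar_mult norm_divide)
        finally show ?thesis using False by (simp add: field_simps)
      qed simp
      moreover have "c * (1 + \<bar>\<omega>\<bar>) \<le> c0 / (1 + R) * (1 + R)"
        using True \<open>c0 > 0\<close> \<open>0 < 1 + R\<close> by (intro mult_mono) (auto simp: c_def)
      then have "c * (1 + \<bar>\<omega>\<bar>) \<le> c0" using \<open>0 < 1 + R\<close> by simp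
      then have "c * (1 + \<bar>\<omega>\<bar>) * norm v \<le> c0 * norm v" by (rule mult_right_mono) simp
      ultimately show ?thesis by linarith
    next
      case False
      have "norm (cmatrix A *v v) \<le> a * norm v"
        unfolding a_def by (rule onorm[OF matrix_vector_mul_bounded_linear])
      moreover have "norm ((\<i> * complex_of_real \<omega>) *s v) - norm (cmatrix A *v v) \<le> norm (S \<omega> *v v)"
        unfolding S by (rule norm_triangle_ineq2)
      ultimately have "(\<bar>\<omega>\<bar> - a) * norm v \<le> norm (S \<omega> *v v)"
        by (simp add: norm_scalar_mult norm_mult left_diff_distrib)
      moreover have "1 / 2 * (1 + \<bar>\<omega>\<bar>) \<le> \<bar>\<omega>\<bar> - a" using False by (simp add: R_def field_simps)
      moreover have "c * (1 + \<bar>\<omega>\<bar>) \<le> 1 / 2 * (1 + \<bar>\<omega>\<bar>)"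
        unfolding c_def by (intro mult_right_mono min.cobounded1) simp
      ultimately show ?thesis
        by (meson mult_right_mono norm_ge_zero order_trans)
    qed
    then show "c * (1 + \<bar>\<omega>\<bar>) * norm v \<le> norm ((mat (\<i> * complex_of_real \<omega>) - cmatrix A) *v v)"
      by (simp add: S_def)
  qed
qed

definition resolvent :: "real^'n^'n \<Rightarrow> real \<Rightarrow> complex^'n^'n" where
  "resolvent A \<omega> = matrix_inv (mat (\<i> * complex_of_real \<omega>) - cmatrix A)"

lemma hurwitz_resolvent:
  assumes "hurwitz A"
  shows "(mat (\<i> * complex_of_real \<omega>) - cmatrix A) *v (resolvent A \<omega> *v v) = v"
    and "resolvent A \<omega> *v ((mat (\<i> * complex_of_real \<omega>) - cmatrix A) *v v) = v"
proof -
  obtain c where c: "c > 0"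
    "\<And>\<omega> v. c * (1 + \<bar>\<omega>\<bar>) * norm v \<le> norm ((mat (\<i> * complex_of_real \<omega>) - cmatrix A) *v v)"
    using hurwitz_resolvent_lower_bound[OF assms] by blast
  have inj: "w = 0" if "(mat (\<i> * complex_of_real \<omega>) - cmatrix A) *v w = 0" for w
  proof -
    have "c * (1 + \<bar>\<omega>\<bar>) * norm w \<le> 0" using c(2)[of \<omega> w] that by simp
    moreover have "0 < c * (1 + \<bar>\<omega>\<bar>)" using c(1) by (intro mult_pos_pos) auto
    ultimately have "norm w \<le> 0" by (metis mult_pos_pos not_le)
    then show ?thesis by simp
  qed
  show "(mat (\<i> * complex_of_real \<omega>) - cmatrix A) *v (resolvent A \<omega> *v v) = v"
    "resolvent A \<omega> *v ((mat (\<i> * complex_of_real \<omega>) - cmatrix A) *v v) = v"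
    using matrix_inv_mult[OF inj] by (simp_all add: resolvent_def matrix_vector_mul_assoc)
qed

lemma hurwitz_resolvent_bound:
  assumes "hurwitz A"
  obtains c where "c > 0" "\<And>\<omega> v. norm (resolvent A \<omega> *v v) \<le> norm v / (c * (1 + \<bar>\<omega>\<bar>))"
proof -
  obtain c where c: "c > 0"
    "\<And>\<omega> v. c * (1 + \<bar>\<omega>\<bar>) * norm v \<le> norm ((mat (\<i> * complex_of_real \<omega>) - cmatrix A) *v v)"
    using hurwitz_resolvent_lower_bound[OF assms] by blast
  have "norm (resolvent A \<omega> *v v) \<le> norm v / (c * (1 + \<bar>\<omega>\<bar>))" for \<omega> v
  proof -
    have "0 < c * (1 + \<bar>\<omega>\<bar>)" using c(1) by (intro mult_pos_pos) auto
    then show ?thesis using c(2)[of \<omega> "resolvent A \<omega> *v v"]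
      by (simp add: hurwitz_resolvent(1)[OF assms] pos_le_divide_eq mult.commute)
  qed
  with c(1) show thesis by (rule that)
qed

lemma resolvent_identity:
  assumes "hurwitz A"
  shows "resolvent A s *v v - resolvent A t *v v = (\<i> * complex_of_real (t - s)) *s (resolvent A s *v (resolvent A t *v v))"
proof -
  let ?w = "resolvent A t *v v"
  have "(mat (\<i> * complex_of_real t) - cmatrix A) *v ?w - (mat (\<i> * complex_of_real s) - cmatrix A) *v ?w
      = (\<i> * complex_of_real (t - s)) *s ?w"
    by (simp add: matrix_vector_mult_diff_rdistrib mat_mult_vector vec_eq_iff algebra_simps)
  then have "v - (mat (\<i> * complex_of_real s) - cmatrix A) *v ?w = (\<i> * complex_of_real (t - s)) *s ?w"
    by (simp only: hurwitz_resolvent(1)[OF assms])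
  then have "resolvent A s *v (v - (mat (\<i> * complex_of_real s) - cmatrix A) *v ?w)
      = resolvent A s *v ((\<i> * complex_of_real (t - s)) *s ?w)" by (rule arg_cong)
  then show ?thesis
    by (simp only: matrix_vector_mult_diff_distrib[of "resolvent A s"] hurwitz_resolvent(2)[OF assms] vector_scalar_commute)
qed

text \<open>The resolvent identity and the bound \<open>norm v / c\<close>, uniform in the
  frequency, give a Lipschitz estimate.\<close>

lemma isCont_resolvent:
  assumes "hurwitz A"
  shows "isCont (\<lambda>\<omega>. resolvent A \<omega> *v v) \<omega>"
proof -
  obtain c where c: "c > 0" "\<And>\<omega> v. norm (resolvent A \<omega> *v v) \<le> norm v / (c * (1 + \<bar>\<omega>\<bar>))"
    using hurwitz_resolvent_bound[OF assms] by blast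
  have le: "norm (resolvent A s *v v) \<le> norm v / c" for s v
  proof -
    have "norm v / (c * (1 + \<bar>s\<bar>)) \<le> norm v / c" using c(1)
      by (intro divide_left_mono) (auto intro!: mult_pos_pos)
    then show ?thesis using c(2)[of s v] by linarith
  qed
  have "norm (resolvent A s *v v - resolvent A \<omega> *v v) \<le> \<bar>\<omega> - s\<bar> * (norm v / c / c)" for s
  proof -
    have "norm (resolvent A s *v (resolvent A \<omega> *v v)) \<le> norm v / c / c"
      using le[of s "resolvent A \<omega> *v v"] le[of \<omega> v] c(1)
      by (meson divide_right_mono less_imp_le order_trans)
    then have "\<bar>\<omega> - s\<bar> * norm (resolvent A s *v (resolvent A \<omega> *v v)) \<le> \<bar>\<omega> - s\<bar> * (norm v / c / c)"
      by (rule mult_left_mono) simp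
    then show ?thesis unfolding resolvent_identity[OF assms]
      by (simp add: norm_scalar_mult norm_mult del: of_real_diff)
  qed
  then have "\<forall>\<^sub>F s in at \<omega>. norm (resolvent A s *v v - resolvent A \<omega> *v v) \<le> \<bar>\<omega> - s\<bar> * (norm v / c / c)" by simp
  moreover have "((\<lambda>s. \<bar>\<omega> - s\<bar> * (norm v / c / c)) \<longlongrightarrow> \<bar>\<omega> - \<omega>\<bar> * (norm v / c / c)) (at \<omega>)"
    by (intro tendsto_intros)
  then have "((\<lambda>s. \<bar>\<omega> - s\<bar> * (norm v / c / c)) \<longlongrightarrow> 0) (at \<omega>)" by simp
  ultimately have "((\<lambda>s. resolvent A s *v v - resolvent A \<omega> *v v) \<longlongrightarrow> 0) (at \<omega>)"
    by (rule Lim_null_comparison)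
  then show ?thesis unfolding isCont_def by (rule Lim_null[THEN iffD2])
qed

section \<open>The input-to-state transfer matrix and the cost form\<close>

lemma matrix_component_axis: "M $ i $ j = (M *v axis j 1) $ i" for M :: "complex^'n^'m"
  by (simp add: matrix_vector_mult_def axis_def if_distrib[of "\<lambda>x. _ * x"] cong: if_cong)

definition input_to_state :: "real^'n^'n \<Rightarrow> real^'m^'n \<Rightarrow> real \<Rightarrow> complex^'m^'n" where
  "input_to_state A B \<omega> = resolvent A \<omega> ** cmatrix B"

lemma input_to_state_component:
  "input_to_state A B \<omega> $ i $ j = (resolvent A \<omega> *v (cmatrix B *v axis j 1)) $ i"
  by (subst matrix_component_axis) (simp only: input_to_state_def matrix_vector_mul_assoc)

lemma isCont_input_to_state:
  assumes "hurwitz A"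
  shows "isCont (input_to_state A B) \<omega>"
  unfolding isCont_def
proof (intro vec_tendstoI)
  show "((\<lambda>s. input_to_state A B s $ i $ j) \<longlongrightarrow> input_to_state A B \<omega> $ i $ j) (at \<omega>)" for i j
    unfolding input_to_state_component
    using isCont_resolvent[OF assms, where v = "cmatrix B *v axis j 1"] by (intro tendsto_vec_nth) (simp add: isCont_def)
qed

text \<open>First-order decay in the frequency makes the squared norm integrable.\<close>

lemma input_to_state_bound:
  assumes "hurwitz A"
  obtains k where "0 \<le> k" "\<And>\<omega>. norm (input_to_state A B \<omega>) \<le> k / (1 + \<bar>\<omega>\<bar>)"
proof -
  obtain c where c: "c > 0" "\<And>\<omega> v. norm (resolvent A \<omega> *v v) \<le> norm v / (c * (1 + \<bar>\<omega>\<bar>))"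
    using hurwitz_resolvent_bound[OF assms] by blast
  define k where "k = (\<Sum>i\<in>(UNIV :: 'a set). \<Sum>j\<in>UNIV. norm (cmatrix B *v axis j 1) / c)"
  show thesis
  proof
    show "0 \<le> k" using c(1) by (simp add: k_def sum_nonneg)
    fix \<omega>
    have row: "norm v \<le> (\<Sum>j\<in>UNIV. norm (v $ j))" for v :: "complex^'b"
      unfolding norm_vec_def by (rule L2_set_le_sum) simp
    have "norm (input_to_state A B \<omega>) \<le> (\<Sum>i\<in>UNIV. norm (input_to_state A B \<omega> $ i))"
      unfolding norm_vec_def[of "input_to_state A B \<omega>"] by (rule L2_set_le_sum) simp
    also have "\<dots> \<le> (\<Sum>i\<in>UNIV. \<Sum>j\<in>UNIV. norm (input_to_state A B \<omega> $ i $ j))"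
      by (intro sum_mono row)
    also have "\<dots> \<le> (\<Sum>i\<in>(UNIV :: 'a set). \<Sum>j\<in>UNIV. norm (cmatrix B *v axis j 1) / (c * (1 + \<bar>\<omega>\<bar>)))"
      unfolding input_to_state_component
      by (intro sum_mono order_trans[OF Finite_Cartesian_Product.norm_nth_le c(2)])
    also have "\<dots> = k / (1 + \<bar>\<omega>\<bar>)" by (simp only: k_def sum_divide_distrib divide_divide_eq_left)
    finally show "norm (input_to_state A B \<omega>) \<le> k / (1 + \<bar>\<omega>\<bar>)" .
  qed
qed

lemma cmatrix_scaleR: "cmatrix (c *\<^sub>R X) = c *\<^sub>R cmatrix X"
  and cmatrix_add: "cmatrix (X + Y) = cmatrix X + cmatrix Y"
  and cmatrix_diff: "cmatrix (X - Y) = cmatrix X - cmatrix Y"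
  by (simp_all add: cmatrix_def vec_eq_iff complex_eq_iff)

lemma cmatrix_mult_distrib:
  "cmatrix (X + Y) ** K = cmatrix X ** K + cmatrix Y ** K"
  "cmatrix (X - Y) ** K = cmatrix X ** K - cmatrix Y ** K"
  "cmatrix (c *\<^sub>R X) ** K = c *\<^sub>R (cmatrix X ** K)"
  by (simp_all add: cmatrix_add cmatrix_diff cmatrix_scaleR matrix_matrix_mult_def vec_eq_iff
      distrib_right left_diff_distrib sum.distrib sum_subtractf scaleR_right.sum)

lemma bounded_linear_cmatrix_mult:
  "bounded_linear (\<lambda>K :: complex^'m^'n. cmatrix X ** K)"
  unfolding linear_conv_bounded_linear[symmetric]
  by (rule linearI) (simp_all add: matrix_matrix_mult_def vec_eq_iff distrib_left sum.distrib scaleR_right.sum)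

text \<open>The cost as a function of the output error alone, since \<open>D\<close> cancels. For
  Hurwitz \<open>A\<close> it is the trace of \<open>E P E\<^sup>T\<close> with \<open>P\<close> the
  controllability Gramian.\<close>

definition h2_form :: "real^'n^'n \<Rightarrow> real^'m^'n \<Rightarrow> real^'n^'p \<Rightarrow> real" where
  "h2_form A B E = 1 / (2 * pi) * (LINT \<omega>|lborel. (norm (cmatrix E ** input_to_state A B \<omega>))\<^sup>2)"

lemma h2_form_nonneg: "0 \<le> h2_form A B E"
  unfolding h2_form_def by (intro mult_nonneg_nonneg Bochner_Integration.integral_nonneg) auto

lemma J_cost_eq: "J_cost A B C D M L = h2_form A B (C - C_hat A B M L)"
proof -
  let ?T = "transfer_function A B"
  have "?T C D (\<i> * complex_of_real \<omega>) - ?T C' D (\<i> * complex_of_real \<omega>) = cmatrix (C - C') ** input_to_state A B \<omega>" for C' \<omega>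
    by (simp add: transfer_function_def input_to_state_def resolvent_def cmatrix_mult_distrib matrix_mul_assoc)
       (simp add: matrix_matrix_mult_def vec_eq_iff cmatrix_diff left_diff_distrib sum_subtractf)
  then have "J_cost A B C D M L = (sqrt (h2_form A B (C - C_hat A B M L)))\<^sup>2"
    by (simp add: J_cost_def h2_norm_def h2_form_def)
  then show ?thesis by (simp add: h2_form_nonneg)
qed

lemma isCont_h2_integrand:
  assumes "hurwitz A"
  shows "isCont (\<lambda>\<omega>. (norm (cmatrix E ** input_to_state A B \<omega>))\<^sup>2) \<omega>"
  by (intro continuous_intros bounded_linear.isCont[OF bounded_linear_cmatrix_mult] isCont_input_to_state assms)

lemma integrable_h2_integrand:
  fixes A :: "real^'n^'n" and B :: "real^'m^'n" and E :: "real^'n^'p"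
  assumes "hurwitz A"
  shows "integrable lborel (\<lambda>\<omega>. (norm (cmatrix E ** input_to_state A B \<omega>))\<^sup>2)"
proof -
  obtain k where k: "0 \<le> k" "\<And>\<omega>. norm (input_to_state A B \<omega>) \<le> k / (1 + \<bar>\<omega>\<bar>)"
    using input_to_state_bound[OF assms] by blast
  obtain b where b: "0 \<le> b" "\<And>K. norm (cmatrix E ** K :: complex^'m^'p) \<le> norm K * b"
    using bounded_linear.nonneg_bounded[OF bounded_linear_cmatrix_mult[of E]] by blast
  show ?thesis
  proof (rule Bochner_Integration.integrable_bound)
    show "integrable lborel (\<lambda>\<omega>. (k * b)\<^sup>2 * inverse (1 + \<omega>\<^sup>2))"
      by (intro integrable_mult_right integrable_inverse_one_plus_square)
    have "continuous_on UNIV (\<lambda>\<omega>. (norm (cmatrix E ** input_to_state A B \<omega>))\<^sup>2)"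
      by (intro continuous_at_imp_continuous_on ballI isCont_h2_integrand[OF assms])
    then show "(\<lambda>\<omega>. (norm (cmatrix E ** input_to_state A B \<omega>))\<^sup>2) \<in> borel_measurable lborel"
      by (simp add: borel_measurable_continuous_onI)
    have "(norm (cmatrix E ** input_to_state A B \<omega>))\<^sup>2 \<le> (k * b)\<^sup>2 * inverse (1 + \<omega>\<^sup>2)" for \<omega>
    proof -
      have "norm (cmatrix E ** input_to_state A B \<omega>) \<le> k * b / (1 + \<bar>\<omega>\<bar>)"
        using order_trans[OF b(2)[of "input_to_state A B \<omega>"] mult_right_mono[OF k(2)[of \<omega>] b(1)]] by simp
      then have "(norm (cmatrix E ** input_to_state A B \<omega>))\<^sup>2 \<le> (k * b / (1 + \<bar>\<omega>\<bar>))\<^sup>2"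
        by (rule power_mono) simp
      also have "\<dots> = (k * b)\<^sup>2 / (1 + \<bar>\<omega>\<bar>)\<^sup>2" by (rule power_divide)
      also have "\<dots> \<le> (k * b)\<^sup>2 / (1 + \<omega>\<^sup>2)"
        by (intro divide_left_mono) (auto simp: power2_sum add_pos_nonneg intro!: mult_pos_pos)
      finally show ?thesis by (simp add: divide_inverse)
    qed
    then show "AE \<omega> in lborel. norm ((norm (cmatrix E ** input_to_state A B \<omega>))\<^sup>2) \<le> norm ((k * b)\<^sup>2 * inverse (1 + \<omega>\<^sup>2))"
      by (intro AE_I2) simp
  qed
qed

text \<open>The norm identity behind strict convexity, integrated over the frequency. Its defect
  term \<open>u * v * h2_form A B (X - Y)\<close> later separates minimisers, and the same identity
  yields homogeneity.\<close>

lemma h2_form_convex_combination: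
  assumes "hurwitz A" "u + v = 1"
  shows "h2_form A B (u *\<^sub>R X + v *\<^sub>R Y) = u * h2_form A B X + v * h2_form A B Y - u * v * h2_form A B (X - Y)"
proof -
  have id: "(norm (u *\<^sub>R x + v *\<^sub>R y))\<^sup>2 = u * (norm x)\<^sup>2 + v * (norm y)\<^sup>2 - u * v * (norm (x - y))\<^sup>2"
    for x y :: "complex^'b^'c"
  proof -
    have v: "v = 1 - u" using assms(2) by simp
    show ?thesis
      by (simp add: v power2_norm_eq_inner inner_add_left inner_add_right inner_diff_left inner_diff_right inner_commute[of y x])
         (simp add: algebra_simps)
  qed
  let ?f = "\<lambda>E \<omega>. (norm (cmatrix E ** input_to_state A B \<omega>))\<^sup>2"
  note int = integrable_h2_integrand[OF assms(1)]
  have "(LINT \<omega>|lborel. ?f (u *\<^sub>R X + v *\<^sub>R Y) \<omega>) = (LINT \<omega>|lborel. u * ?f X \<omega> + v * ?f Y \<omega> - u * v * ?f (X - Y) \<omega>)"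
    by (simp only: cmatrix_mult_distrib id)
  also have "\<dots> = u * (LINT \<omega>|lborel. ?f X \<omega>) + v * (LINT \<omega>|lborel. ?f Y \<omega>) - u * v * (LINT \<omega>|lborel. ?f (X - Y) \<omega>)"
    using int[of X B] int[of Y B] int[of "X - Y" B] by simp
  finally show ?thesis unfolding h2_form_def by (simp only: right_diff_distrib distrib_left mult_ac)
qed

text \<open>The integrand vanishes at every frequency. The real directions that the resolvent
  followed by \<open>E\<close> annihilates at all frequencies then form an
  \<open>A\<close>-invariant set inside the kernel of \<open>E\<close> that contains the range of
  \<open>B\<close>, so controllability kills each row of \<open>E\<close>.\<close>

lemma h2_form_eq_0_imp:
  fixes A :: "real^'n^'n" and B :: "real^'m^'n" and E :: "real^'n^'p"
  assumes "hurwitz A" "controllable A B" "h2_form A B E = 0"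
  shows "E = 0"
proof -
  let ?f = "\<lambda>\<omega>. (norm (cmatrix E ** input_to_state A B \<omega>))\<^sup>2"
  have "(LINT \<omega>|lborel. ?f \<omega>) = 0" using assms(3) by (simp add: h2_form_def)
  then have "AE \<omega> in lborel. ?f \<omega> = 0"
    using iffD1[OF integral_nonneg_eq_0_iff_AE[OF integrable_h2_integrand[OF assms(1), of E B] AE_I2]] by simp
  then have "AE \<omega> in lebesgue. ?f \<omega> = 0" by (rule AE_completion)
  then have "negligible {\<omega>. ?f \<omega> \<noteq> 0}"
    by (simp add: negligible_iff_null_sets AE_iff_null_sets eventually_ae_filter)
       (metis (mono_tags, lifting) null_sets_completion_subset)
  \<comment> \<open>By continuity a nonzero value would persist on an open set, which is not
    negligible.\<close>
  moreover have "open {\<omega>. ?f \<omega> \<noteq> 0}"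
    by (intro open_Collect_neq continuous_at_imp_continuous_on ballI isCont_h2_integrand[OF assms(1)] continuous_const)
  ultimately have "{\<omega>. ?f \<omega> \<noteq> 0} = {}" using open_not_negligible by blast
  then have zero: "cmatrix E ** input_to_state A B \<omega> = 0" for \<omega> by auto
  define S where "S = {s. \<forall>\<omega>. cmatrix E *v (resolvent A \<omega> *v cvector s) = 0}"
  have key: "cmatrix E *v (resolvent A \<omega> *v cvector (A *v s)) = - cvector (E *v s)" if "s \<in> S" for s \<omega>
  proof -
    have "(mat (\<i> * complex_of_real \<omega>) - cmatrix A) *v cvector s = (\<i> * complex_of_real \<omega>) *s cvector s - cvector (A *v s)"
      by (simp add: matrix_vector_mult_diff_rdistrib mat_mult_vector cmatrix_mult_cvector)
    then have "cvector s = (\<i> * complex_of_real \<omega>) *s (resolvent A \<omega> *v cvector s) - resolvent A \<omega> *v cvector (A *v s)"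
      using hurwitz_resolvent(2)[OF assms(1), of \<omega> "cvector s"]
      by (simp add: matrix_vector_mult_diff_distrib vector_scalar_commute)
    from arg_cong[OF this, of "(*v) (cmatrix E)"] that
    have "cvector (E *v s) = - (cmatrix E *v (resolvent A \<omega> *v cvector (A *v s)))"
      by (simp add: S_def matrix_vector_mult_diff_distrib vector_scalar_commute cmatrix_mult_cvector)
    then show ?thesis by simp
  qed
  obtain c where c: "c > 0" "\<And>\<omega> v. norm (resolvent A \<omega> *v v) \<le> norm v / (c * (1 + \<bar>\<omega>\<bar>))"
    using hurwitz_resolvent_bound[OF assms(1)] by blast
  \<comment> \<open>By \<open>key\<close>, \<open>E s\<close> equals, up to sign, an expression
    valid at every frequency; the resolvent in it decays at high frequency, so \<open>E s\<close> is
    0.\<close>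
  have ES: "E *v s = 0" if "s \<in> S" for s
  proof -
    have "(\<lambda>k. resolvent A (real k) *v cvector (A *v s)) \<longlonglongrightarrow> 0"
    proof (rule Lim_null_comparison)
      show "\<forall>\<^sub>F k in sequentially. norm (resolvent A (real k) *v cvector (A *v s)) \<le> norm (cvector (A *v s)) / c * (1 / real (Suc k))"
        by (intro always_eventually allI order_trans[OF c(2)]) simp
      show "(\<lambda>k. norm (cvector (A *v s)) / c * (1 / real (Suc k))) \<longlonglongrightarrow> 0"
        using tendsto_mult[OF tendsto_const[of "norm (cvector (A *v s)) / c"] LIMSEQ_Suc[OF lim_1_over_n]] by simp
    qed
    from bounded_linear.tendsto[OF matrix_vector_mul_bounded_linear[of "cmatrix E"] this]
    have "(\<lambda>k :: nat. - cvector (E *v s)) \<longlonglongrightarrow> 0" by (simp add: key[OF that])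
    then have "cvector (E *v s) = 0" by (simp add: LIMSEQ_const_iff)
    then show ?thesis by (simp add: cvector_def vec_eq_iff)
  qed
  have "E $ i = 0" for i
  proof (rule controllable_imp_orthogonal_complement_zero[OF assms(2)])
    show "A *v s \<in> S" if "s \<in> S" for s
      using key[OF that] ES[OF that] by (simp add: S_def cvector_def vec_eq_iff)
    show "B *v u \<in> S" for u
    proof -
      have "cmatrix E *v (resolvent A \<omega> *v cvector (B *v u)) = (cmatrix E ** input_to_state A B \<omega>) *v cvector u" for \<omega>
        by (simp only: input_to_state_def matrix_vector_mul_assoc[symmetric] cmatrix_mult_cvector)
      then show ?thesis by (simp add: S_def zero)
    qed
    show "E $ i \<bullet> s = 0" if "s \<in> S" for s
      using ES[OF that] by (metis matrix_vector_mul_component zero_index)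
  qed
  then show ?thesis by (simp add: vec_eq_iff)
qed

text \<open>A finite convex function on a finite-dimensional space is continuous, so no estimate of
  the integral is needed.\<close>

lemma continuous_on_h2_form:
  fixes A :: "real^'n^'n" and B :: "real^'m^'n"
  assumes "hurwitz A"
  shows "continuous_on UNIV (h2_form A B :: real^'n^'p \<Rightarrow> real)"
proof (rule convex_on_continuous)
  show "convex_on UNIV (h2_form A B :: real^'n^'p \<Rightarrow> real)"
    unfolding convex_on_def
  proof (intro conjI convex_UNIV ballI allI impI)
    fix X Y :: "real^'n^'p" and u v :: real
    assume "0 \<le> u" "0 \<le> v" "u + v = 1"
    moreover have "0 \<le> u * v * h2_form A B (X - Y)"
      using \<open>0 \<le> u\<close> \<open>0 \<le> v\<close> by (intro mult_nonneg_nonneg h2_form_nonneg)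
    ultimately show "h2_form A B (u *\<^sub>R X + v *\<^sub>R Y) \<le> u * h2_form A B X + v * h2_form A B Y"
      using h2_form_convex_combination[OF assms, of u v B X Y] by linarith
  qed
qed simp

lemma h2_form_scaleR:
  fixes A :: "real^'n^'n" and B :: "real^'m^'n" and X :: "real^'n^'p"
  assumes "hurwitz A"
  shows "h2_form A B (c *\<^sub>R X) = c\<^sup>2 * h2_form A B X"
proof -
  have "cmatrix (0 :: real^'n^'p) ** K = 0" for K :: "complex^'m^'n"
    by (simp add: cmatrix_def matrix_matrix_mult_def vec_eq_iff)
  then have "h2_form A B (0 :: real^'n^'p) = 0" by (simp add: h2_form_def)
  then show ?thesis using h2_form_convex_combination[OF assms, of c "1 - c" B X 0]
    by (simp add: power2_eq_square algebra_simps)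
qed

lemma h2_form_lower_bound:
  fixes A :: "real^'n^'n" and B :: "real^'m^'n"
  assumes "hurwitz A" "controllable A B"
  obtains c where "c > 0" "\<And>E :: real^'n^'p. c * (norm E)\<^sup>2 \<le> h2_form A B E"
proof -
  let ?S = "sphere (0 :: real^'n^'p) 1"
  obtain b :: "real^'n^'p" where "b \<in> Basis" using nonempty_Basis by blast
  then have "b \<in> ?S" by simp
  then have "?S \<noteq> {}" by blast
  then obtain V where V: "V \<in> ?S" "\<And>X. X \<in> ?S \<Longrightarrow> h2_form A B V \<le> h2_form A B X"
    using continuous_attains_inf[OF compact_sphere _ continuous_on_subset[OF continuous_on_h2_form[OF assms(1)] subset_UNIV]]
    by blast
  show thesis
  proof
    show "0 < h2_form A B V"
      using h2_form_eq_0_imp[OF assms, of V] h2_form_nonneg[of A B V] V(1) by (auto simp: less_le)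
    show "h2_form A B V * (norm E)\<^sup>2 \<le> h2_form A B E" for E :: "real^'n^'p"
    proof (cases "E = 0")
      case False
      have "h2_form A B V \<le> h2_form A B ((1 / norm E) *\<^sub>R E)" using False by (intro V(2)) simp
      then show ?thesis using False by (simp add: h2_form_scaleR[OF assms(1)] field_simps)
    qed (simp add: h2_form_nonneg)
  qed
qed

section \<open>Passivity\<close>

text \<open>A form of "zero derivative implies constant" for functions that need not be
  differentiable: small increments of \<open>p\<close> are compared with those of \<open>m\<close>,
  and bisection makes the comparison global.\<close>

lemma eq_of_local_increments:
  fixes p m :: "real \<Rightarrow> real"
  assumes "a \<le> b"
    and local: "\<And>e r. \<lbrakk>0 < e; a \<le> r; r \<le> b\<rbrakk> \<Longrightarrow> \<exists>d>0. \<forall>s t. a \<le> s \<and> s \<le> r \<and> r \<le> t \<and> t \<le> b \<and> t - s < d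
        \<longrightarrow> \<bar>p t - p s\<bar> \<le> e * (m t - m s)"
  shows "p b = p a"
proof -
  have bound: "\<bar>p b - p a\<bar> \<le> e * (m b - m a)" if "0 < e" for e
  proof -
    have "a \<le> a \<and> b \<le> b \<longrightarrow> \<bar>p b - p a\<bar> \<le> e * (m b - m a)"
    proof (rule Bolzano[where P="\<lambda>s t. a \<le> s \<and> t \<le> b \<longrightarrow> \<bar>p t - p s\<bar> \<le> e * (m t - m s)", OF \<open>a \<le> b\<close>])
      fix r s t
      assume "a \<le> r \<and> s \<le> b \<longrightarrow> \<bar>p s - p r\<bar> \<le> e * (m s - m r)" "a \<le> s \<and> t \<le> b \<longrightarrow> \<bar>p t - p s\<bar> \<le> e * (m t - m s)"
        "r \<le> s" "s \<le> t"
      then show "a \<le> r \<and> t \<le> b \<longrightarrow> \<bar>p t - p r\<bar> \<le> e * (m t - m r)"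
        unfolding right_diff_distrib by linarith
    next
      fix r assume "a \<le> r" "r \<le> b"
      from local[OF that this]
      show "\<exists>d>0. \<forall>s t. s \<le> r \<and> r \<le> t \<and> t - s < d \<longrightarrow> a \<le> s \<and> t \<le> b \<longrightarrow> \<bar>p t - p s\<bar> \<le> e * (m t - m s)"
        by blast
    qed
    then show ?thesis by simp
  qed
  show ?thesis
  proof (rule ccontr)
    assume neq: "p b \<noteq> p a"
    define c where "c = \<bar>m b - m a\<bar> + 1"
    have "c > 0" by (simp add: c_def)
    have "\<bar>p b - p a\<bar> \<le> \<bar>p b - p a\<bar> / (2 * c) * (m b - m a)" using neq \<open>c > 0\<close> by (intro bound) simp
    also have "\<dots> \<le> \<bar>p b - p a\<bar> / (2 * c) * c" using \<open>c > 0\<close> by (intro mult_left_mono) (auto simp: c_def)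
    also have "\<dots> = \<bar>p b - p a\<bar> / 2" using \<open>c > 0\<close> by simp
    finally show False using neq by simp
  qed
qed

text \<open>The chain rule for a curve known only as an integral. The increment of the form over a
  short interval is the integral of \<open>(x t + x s) \<bullet> Q f\<close>; replacing
  \<open>x t + x s\<close> by \<open>2 x\<close> costs at most the oscillation of \<open>x\<close>
  times the integral of \<open>norm (Q f)\<close>.\<close>

lemma quadratic_form_has_integral:
  fixes x f :: "real \<Rightarrow> real^'n"
  assumes "a \<le> b" and sym: "transpose Q = Q" and f: "f absolutely_integrable_on {a..b}"
    and x: "\<And>s t. \<lbrakk>a \<le> s; s \<le> t; t \<le> b\<rbrakk> \<Longrightarrow> (f has_integral (x t - x s)) {s..t}"
    and cont: "continuous_on {a..b} x"
  shows "((\<lambda>t. 2 * (x t \<bullet> (Q *v f t))) has_integral (x b \<bullet> (Q *v x b) - x a \<bullet> (Q *v x a))) {a..b}"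
proof -
  define h where "h = (\<lambda>t. 2 * (x t \<bullet> (Q *v f t)))"
  have Qf: "(\<lambda>t. Q *v f t) absolutely_integrable_on {a..b}"
    using absolutely_integrable_linear[OF f matrix_vector_mul_bounded_linear[of Q]] by (simp add: o_def)
  have "(\<lambda>t. x t \<bullet> (Q *v f t)) absolutely_integrable_on {a..b}"
    by (rule absolutely_integrable_bounded_measurable_product[OF _ _ _ _ Qf])
       (auto simp: bilinear_conv_bounded_bilinear bounded_bilinear_inner intro!: continuous_imp_measurable_on_sets_lebesgue cont
          compact_imp_bounded compact_continuous_image)
  then have h: "h integrable_on {a..b}" unfolding h_def
    using absolutely_integrable_on_def integrable_on_mult_right by blast
  have h_sub: "h integrable_on {s..t}" if "a \<le> s" "t \<le> b" for s t
    by (rule integrable_on_subinterval[OF h]) (use that in auto)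
  define g where "g = (\<lambda>t. norm (Q *v f t))"
  have g: "g integrable_on {a..b}" using Qf unfolding g_def absolutely_integrable_on_def by blast
  have g_sub: "g integrable_on {s..t}" if "a \<le> s" "t \<le> b" for s t
    by (rule integrable_on_subinterval[OF g]) (use that in auto)
  define p where "p = (\<lambda>t. x t \<bullet> (Q *v x t) - integral {a..t} h)"
  define m where "m = (\<lambda>t. integral {a..t} g)"
  have h_diff: "integral {a..t} h - integral {a..s} h = integral {s..t} h" if "a \<le> s" "s \<le> t" "t \<le> b" for s t
    using Henstock_Kurzweil_Integration.integral_combine[OF that(1,2) h_sub] that by simp
  have g_diff: "m t - m s = integral {s..t} g" if "a \<le> s" "s \<le> t" "t \<le> b" for s t
    using Henstock_Kurzweil_Integration.integral_combine[OF that(1,2) g_sub] that by (simp add: m_def)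
  have "p b = p a"
  proof (rule eq_of_local_increments[OF \<open>a \<le> b\<close>])
    fix e r :: real assume er: "0 < e" "a \<le> r" "r \<le> b"
    \<comment> \<open>The error below is made of four deviations from \<open>x r\<close>, each
      allowed \<open>e / 4\<close>.\<close>
    obtain d where d: "d > 0" "\<And>t. t \<in> {a..b} \<Longrightarrow> dist t r < d \<Longrightarrow> dist (x t) (x r) < e / 4"
      using cont[unfolded continuous_on_iff, rule_format, of r "e / 4"] er by auto
    have "\<bar>p t - p s\<bar> \<le> e * (m t - m s)" if st: "a \<le> s" "s \<le> r" "r \<le> t" "t \<le> b" "t - s < d" for s t
    proof -
      have near: "norm (x q - x r) \<le> e / 4" if "q \<in> {s..t}" for q
        using d(2)[of q] that st by (simp add: dist_norm less_imp_le dist_real_def abs_less_iff)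
      have "((\<lambda>q. (x t + x s) \<bullet> (Q *v f q)) has_integral (x t + x s) \<bullet> (Q *v (x t - x s))) {s..t}"
        using has_integral_linear[OF x bounded_linear_compose[OF bounded_linear_inner_right[of "x t + x s"] matrix_vector_mul_bounded_linear[of Q]], of s t] st
        by (simp add: o_def)
      moreover have "(x t + x s) \<bullet> (Q *v (x t - x s)) = x t \<bullet> (Q *v x t) - x s \<bullet> (Q *v x s)"
        using sym_matrix_dot[OF sym, of "x s" "x t"]
        by (simp add: matrix_vector_mult_diff_distrib inner_add_left inner_diff_right inner_commute[of "Q *v x s"])
      ultimately have "((\<lambda>q. (x t + x s) \<bullet> (Q *v f q) - h q) has_integral
          x t \<bullet> (Q *v x t) - x s \<bullet> (Q *v x s) - integral {s..t} h) {s..t}"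
        using has_integral_diff[OF _ integrable_integral[OF h_sub]] st by fastforce
      then have int: "((\<lambda>q. (x t + x s) \<bullet> (Q *v f q) - h q) has_integral p t - p s) {s..t}"
        using h_diff[of s t] st by (simp add: p_def algebra_simps)
      have "norm (integral {s..t} (\<lambda>q. (x t + x s) \<bullet> (Q *v f q) - h q)) \<le> integral {s..t} (\<lambda>q. e * g q)"
      proof (rule integral_norm_bound_integral[OF has_integral_integrable[OF int]])
        show "(\<lambda>q. e * g q) integrable_on {s..t}" using g_sub[of s t] st by (intro integrable_on_mult_right) auto
        fix q assume q: "q \<in> {s..t}"
        have "(x t + x s) \<bullet> (Q *v f q) - h q = ((x t - x r) + (x s - x r) - 2 *\<^sub>R (x q - x r)) \<bullet> (Q *v f q)"
          unfolding h_def inner_add_left inner_diff_left inner_scaleR_left by simp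
        also have "norm \<dots> \<le> norm ((x t - x r) + (x s - x r) - 2 *\<^sub>R (x q - x r)) * g q"
          unfolding g_def real_norm_def by (rule Cauchy_Schwarz_ineq2)
        also have "\<dots> \<le> e * g q"
        proof (rule mult_right_mono)
          have "norm ((x t - x r) + (x s - x r) - 2 *\<^sub>R (x q - x r))
              \<le> norm (x t - x r) + norm (x s - x r) + norm (2 *\<^sub>R (x q - x r))"
            by (intro order_trans[OF norm_triangle_ineq4] add_right_mono norm_triangle_ineq)
          moreover have "norm (2 *\<^sub>R (x q - x r)) \<le> e / 2" using near[OF q] by simp
          ultimately show "norm ((x t - x r) + (x s - x r) - 2 *\<^sub>R (x q - x r)) \<le> e"
            using near[of t] near[of s] st by simp
        qed (simp add: g_def)
        finally show "norm ((x t + x s) \<bullet> (Q *v f q) - h q) \<le> e * g q" .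
      qed
      then show ?thesis using g_diff[of s t] st by (simp add: integral_unique[OF int])
    qed
    then show "\<exists>d>0. \<forall>s t. a \<le> s \<and> s \<le> r \<and> r \<le> t \<and> t \<le> b \<and> t - s < d \<longrightarrow> \<bar>p t - p s\<bar> \<le> e * (m t - m s)"
      using d(1) by blast
  qed
  then have "integral {a..b} h = x b \<bullet> (Q *v x b) - x a \<bullet> (Q *v x a)" by (simp add: p_def)
  then show ?thesis using integrable_integral[OF h] by (simp add: h_def)
qed

lemma locally_L2_absolutely_integrable:
  assumes "locally_L2 u"
  shows "u absolutely_integrable_on {a..b}" "(\<lambda>t. (norm (u t))\<^sup>2) absolutely_integrable_on {a..b}"
proof -
  show sq: "(\<lambda>t. (norm (u t))\<^sup>2) absolutely_integrable_on {a..b}" using assms unfolding locally_L2_def by blast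
  show "u absolutely_integrable_on {a..b}"
  proof (rule measurable_bounded_by_integrable_imp_absolutely_integrable)
    show "u \<in> borel_measurable (lebesgue_on {a..b})"
      using assms unfolding locally_L2_def by (auto intro: measurable_restrict_space1)
    show "(\<lambda>t. 1 + (norm (u t))\<^sup>2) integrable_on {a..b}"
      using sq unfolding absolutely_integrable_on_def by (intro integrable_add integrable_const_ivl) auto
    show "norm (u t) \<le> 1 + (norm (u t))\<^sup>2" for t
      using zero_le_power2[of "norm (u t) - 1"] by (simp add: power2_eq_square algebra_simps)
         (smt (verit) norm_ge_zero)
  qed simp
qed

lemma supply_integrable:
  assumes "locally_L2 u" "continuous_on {a..b} x" "a \<le> b"
  shows "(\<lambda>t. u t \<bullet> (C *v x t + D *v u t)) integrable_on {a..b}"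
proof -
  note u = locally_L2_absolutely_integrable[OF assms(1), of a b]
  have "continuous_on {a..b} (\<lambda>t. C *v x t)"
    using bounded_linear.continuous_on[OF matrix_vector_mul_bounded_linear assms(2)] .
  then have "(\<lambda>t. (C *v x t) \<bullet> u t) absolutely_integrable_on {a..b}"
    by (intro absolutely_integrable_bounded_measurable_product[OF _ _ _ _ u(1)])
       (auto simp: bilinear_conv_bounded_bilinear bounded_bilinear_inner intro!: continuous_imp_measurable_on_sets_lebesgue
          compact_imp_bounded compact_continuous_image)
  moreover have "(\<lambda>t. u t \<bullet> (D *v u t)) absolutely_integrable_on {a..b}"
  proof (rule measurable_bounded_by_integrable_imp_absolutely_integrable)
    have um: "u \<in> borel_measurable (lebesgue_on {a..b})"
      using assms unfolding locally_L2_def by (auto intro: measurable_restrict_space1)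
    have "(\<lambda>t. D *v u t) \<in> borel_measurable (lebesgue_on {a..b})"
      by (intro measurable_compose[OF um] borel_measurable_continuous_onI linear_continuous_on matrix_vector_mul_bounded_linear)
    with um show "(\<lambda>t. u t \<bullet> (D *v u t)) \<in> borel_measurable (lebesgue_on {a..b})" by measurable
    show "(\<lambda>t. onorm ((*v) D) * (norm (u t))\<^sup>2) integrable_on {a..b}"
      using u(2) unfolding absolutely_integrable_on_def by (intro integrable_on_mult_right) auto
    show "norm (u t \<bullet> (D *v u t)) \<le> onorm ((*v) D) * (norm (u t))\<^sup>2" for t
    proof -
      have "norm (u t \<bullet> (D *v u t)) \<le> norm (u t) * norm (D *v u t)" by (simp add: Cauchy_Schwarz_ineq2)
      also have "\<dots> \<le> norm (u t) * (onorm ((*v) D) * norm (u t))"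
        by (intro mult_left_mono onorm matrix_vector_mul_bounded_linear) simp
      finally show ?thesis by (simp add: power2_eq_square mult_ac)
    qed
  qed simp
  ultimately have "(\<lambda>t. (C *v x t) \<bullet> u t + u t \<bullet> (D *v u t)) absolutely_integrable_on {a..b}"
    by (rule set_integral_add(1))
  then show ?thesis unfolding absolutely_integrable_on_def by (simp add: inner_add_right inner_commute)
qed

text \<open>The energy balance integrated along a trajectory. It holds for every \<open>L\<close>,
  so passivity of the minimising system does not depend on optimality.\<close>

lemma passive_system_C_hat:
  fixes A :: "real^'n^'n" and B :: "real^'m^'n"
  assumes stable: "lyapunov_stable A" and M: "psd_sqrt_of M (D + transpose D)"
  shows "passive_system A B (C_hat A B M L) D"
proof -
  have Msym: "transpose M = M" and MM: "M ** M = D + transpose D"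
    using M by (auto simp: psd_sqrt_of_def sym_psd_def)
  note d = dissipation_C_hat[OF stable Msym]
  define Q where "Q = inv (lyapunov A) (- (L ** transpose L))"
  \<comment> \<open>Only the symmetric part of \<open>D\<close> contributes to the supplied
    energy.\<close>
  have uDu: "u \<bullet> (D *v u) = (norm (M *v u))\<^sup>2 / 2" for u
  proof -
    have "(norm (M *v u))\<^sup>2 = u \<bullet> ((M ** M) *v u)"
      unfolding power2_norm_eq_inner sym_matrix_dot[OF Msym] matrix_vector_mul_assoc ..
    also have "\<dots> = u \<bullet> (D *v u) + u \<bullet> (transpose D *v u)"
      unfolding MM matrix_vector_mult_add_rdistrib inner_add_right ..
    also have "u \<bullet> (transpose D *v u) = u \<bullet> (D *v u)"
      unfolding inner_commute[of u] transpose_dot ..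
    finally show ?thesis by simp
  qed
  show ?thesis unfolding passive_system_def
  proof (intro exI[of _ "\<lambda>z. (z \<bullet> (Q *v z)) / 2"] conjI allI impI)
    show "0 \<le> (z \<bullet> (Q *v z)) / 2" for z using d(2) by (simp add: Q_def)
    fix u x y and t1 t2 :: real
    assume "solution_trajectory A B (C_hat A B M L) D u x y \<and> t1 \<le> t2"
    then have tr: "state_trajectory A B u x" and y: "\<And>t. y t = C_hat A B M L *v x t + D *v u t" and t: "t1 \<le> t2"
      by (auto simp: solution_trajectory_def)
    have u: "locally_L2 u" using tr by (simp add: state_trajectory_def)
    note cont = state_trajectory_continuous[OF tr t]
    let ?f = "\<lambda>t. A *v x t + B *v u t"
    have "?f absolutely_integrable_on {t1..t2}"
    proof (rule set_integral_add(1))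
      show "(\<lambda>t. A *v x t) absolutely_integrable_on {t1..t2}"
        using bounded_linear.continuous_on[OF matrix_vector_mul_bounded_linear cont]
        by (rule absolutely_integrable_continuous_real)
      show "(\<lambda>t. B *v u t) absolutely_integrable_on {t1..t2}"
        using absolutely_integrable_linear[OF locally_L2_absolutely_integrable(1)[OF u] matrix_vector_mul_bounded_linear[of B]]
        by (simp add: o_def)
    qed
    then have Q: "((\<lambda>t. 2 * (x t \<bullet> (Q *v ?f t))) has_integral (x t2 \<bullet> (Q *v x t2) - x t1 \<bullet> (Q *v x t1))) {t1..t2}"
      using tr cont d(1) unfolding Q_def state_trajectory_def
      by (intro quadratic_form_has_integral t) auto
    have uy: "(\<lambda>t. u t \<bullet> y t) integrable_on {t1..t2}" unfolding y
      by (rule supply_integrable[OF u cont t])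
    have "2 * (x t \<bullet> (Q *v ?f t)) \<le> 2 * (u t \<bullet> y t)" for t
      using d(3)[of "x t" L B "u t"] uDu[of "u t"] zero_le_power2[of "norm (transpose L *v x t + M *v u t)"]
      unfolding y inner_add_right Q_def distrib_left by linarith
    then have "x t2 \<bullet> (Q *v x t2) - x t1 \<bullet> (Q *v x t1) \<le> 2 * integral {t1..t2} (\<lambda>t. u t \<bullet> y t)"
      using has_integral_le[OF Q has_integral_mult_right[OF integrable_integral[OF uy], of 2]] by blast
    then show "x t2 \<bullet> (Q *v x t2) / 2 \<le> x t1 \<bullet> (Q *v x t1) / 2 + integral {t1..t2} (\<lambda>t. u t \<bullet> y t)"
      by simp
  qed
qed

section \<open>Existence, uniqueness and passivity of the minimising system\<close>

theorem theorem3p4: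
  fixes A :: "real^'n^'n" and B :: "real^'m^'n" and C :: "real^'n^'m"
    and D M :: "real^'m^'m"
  assumes "hurwitz A"
    and "controllable A B"
    and "sym_psd (D + transpose D)"
    and "psd_sqrt_of M (D + transpose D)"
  shows "(\<exists>L. is_arg_min (J_cost A B C D M) (\<lambda>_. True) L)
    \<and> (\<forall>L1 L2. is_arg_min (J_cost A B C D M) (\<lambda>_. True) L1 \<and> is_arg_min (J_cost A B C D M) (\<lambda>_. True) L2
          \<longrightarrow> C_hat A B M L1 = C_hat A B M L2)
    \<and> (\<forall>L. is_arg_min (J_cost A B C D M) (\<lambda>_. True) L \<longrightarrow> passive_system A B (C_hat A B M L) D)"
proof (intro conjI allI impI)
  have stable: "lyapunov_stable A" by (rule hurwitz_imp_lyapunov_stable[OF assms(1)])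
  have M: "sym_psd M" using assms(4) by (simp add: psd_sqrt_of_def)
  let ?J = "\<lambda>L. h2_form A B (C - C_hat A B M L)"
  have J: "J_cost A B C D M = ?J" by (rule ext) (rule J_cost_eq)
  have arg_min: "is_arg_min (J_cost A B C D M) (\<lambda>_. True) L \<longleftrightarrow> (\<forall>L'. ?J L \<le> ?J L')" for L
    unfolding J by (auto simp: is_arg_min_def not_less)
  show "passive_system A B (C_hat A B M L) D" for L by (rule passive_system_C_hat[OF stable assms(4)])
  show "\<exists>L. is_arg_min (J_cost A B C D M) (\<lambda>_. True) L"
  proof -
    have "isCont (C_hat A B M) L" for L
      unfolding isCont_def by (intro tendsto_C_hat[OF stable] tendsto_const tendsto_ident_at)
    then have "continuous_on UNIV (C_hat A B M)" by (simp add: continuous_at_imp_continuous_on)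
    then have cont: "continuous_on UNIV ?J"
      by (intro continuous_on_compose2[OF continuous_on_h2_form[OF assms(1)]] continuous_intros) auto
    \<comment> \<open>The sublevel set of the cost at \<open>L = 0\<close> is nonempty, and
      coercivity of both the form and \<open>C_hat\<close> makes it compact.\<close>
    define S where "S = {L. ?J L \<le> ?J 0}"
    obtain c where c: "c > 0" "\<And>E :: real^'n^'m. c * (norm E)\<^sup>2 \<le> h2_form A B E"
      using h2_form_lower_bound[OF assms(1,2)] by blast
    have "norm (C_hat A B M L) \<le> norm C + sqrt (?J 0 / c)" if "L \<in> S" for L
    proof -
      have "c * (norm (C - C_hat A B M L))\<^sup>2 \<le> ?J 0"
        using c(2)[of "C - C_hat A B M L"] that by (simp add: S_def)
      then have "norm (C - C_hat A B M L) \<le> sqrt (?J 0 / c)"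
        using c(1) by (intro real_le_rsqrt) (simp add: field_simps)
      then show ?thesis using norm_triangle_ineq4[of C "C - C_hat A B M L"] by simp
    qed
    then have "bounded S"
      by (intro bounded_subset[OF C_hat_coercive[OF stable assms(2), of M "norm C + sqrt (?J 0 / c)"]]) auto
    moreover have "closed S" unfolding S_def using cont by (intro closed_Collect_le continuous_on_const)
    ultimately have "compact S" by (simp add: compact_eq_bounded_closed)
    moreover have "0 \<in> S" by (simp add: S_def)
    ultimately obtain L where L: "L \<in> S" "\<And>L'. L' \<in> S \<Longrightarrow> ?J L \<le> ?J L'"
      using continuous_attains_inf[of S ?J] continuous_on_subset[OF cont subset_UNIV] by blast
    have "?J L \<le> ?J L'" for L'
      using L(2)[of L'] L(2)[OF \<open>0 \<in> S\<close>] by (cases "L' \<in> S") (auto simp: S_def)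
    then show ?thesis unfolding arg_min by blast
  qed
  fix L1 L2
  assume "is_arg_min (J_cost A B C D M) (\<lambda>_. True) L1 \<and> is_arg_min (J_cost A B C D M) (\<lambda>_. True) L2"
  then have min: "?J L1 \<le> ?J L" "?J L2 \<le> ?J L" for L unfolding arg_min by blast+
  obtain L where L: "C_hat A B M L = (1 / 2) *\<^sub>R (C_hat A B M L1 + C_hat A B M L2)"
    using C_hat_midpoint[OF stable M] by blast
  let ?E = "\<lambda>L. C - C_hat A B M L"
  have "?E L = (1 / 2) *\<^sub>R ?E L1 + (1 / 2) *\<^sub>R ?E L2"
    unfolding L by (simp add: scaleR_right_diff_distrib scaleR_right_distrib scaleR_half_double[symmetric] vec_eq_iff)
  \<comment> \<open>The midpoint would undercut the minimum by a quarter of the form at the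
    difference of the errors, so that value must be 0.\<close>
  then have "?J L = ?J L1 / 2 + ?J L2 / 2 - h2_form A B (?E L1 - ?E L2) / 4"
    using h2_form_convex_combination[OF assms(1), of "1 / 2" "1 / 2" B "?E L1" "?E L2"] by simp
  then have "h2_form A B (?E L1 - ?E L2) = 0"
    using min[of L] h2_form_nonneg[of A B "?E L1 - ?E L2"] by linarith
  then have "?E L1 - ?E L2 = 0" by (rule h2_form_eq_0_imp[OF assms(1,2)])
  then show "C_hat A B M L1 = C_hat A B M L2" by simp
qed

end
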